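(* For every even integer $m \geq 4$ there exist (families of) rational functions $f(x) \in \mathbb{C}(x)$ of degree $m$ such that the fixed-point process associated with the profinite iterated monodromy group $G(f)$ is not a martingale.
   Context: For a rational function $f$ of degree $d \ge 2$ over a field $k$ and an indeterminate $t$, let $K_n$ be the splitting field of $f^n(x)-t$ over $k(t)$ ($f^n$ the $n$-th iterate) and $G_n=\mathrm{Gal}(K_n/k(t))$. The sets $f^{-n}(t)$, $n\ge 0$, form a complete rooted $d$-ary tree $X^*$ (with $n$-th level $X_n=f^{-n}(t)$, and $\beta\in X_n$ joined to $f(\beta)\in X_{n-1}$), on which each $G_n$ acts, compatibly with restriction maps $G_n\to G_{n-1}$. The profinite iterated monodromy group is $G(f)=\varprojlim G_n \le \mathrm{Aut}(X^* )$. For $G\le \mathrm{Aut}(X^* )$ closed, equipped with its Haar probability measure, the fixed-point process is the sequence of random variables $Y_n(g)=\#\{v\in X_n : \pi_n(g)(v)=v\}$, where $\pi_n$ is restriction to the first $n$ levels. A process $Y_1,Y_2,\dots$ is a martingale if for all $n\ge 2$ and all reals $t_1,\dots,t_{n-1}$ with $\mathrm{Prob}(Y_1=t_1,\dots,Y_{n-1}=t_{n-1})>0$ one has $E(Y_n\mid Y_1=t_1,\dots,Y_{n-1}=t_{n-1})=t_{n-1}$. *)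

theory Defs
  imports
    "HOL-Probability.Probability"
    "HOL-Algebra.Algebraic_Closure_Type"
    "HOL-Algebra.Bij"
    "HOL-Algebra.Generated_Fields"
begin

section \<open>Rational functions\<close>

text \<open>The type \<^typ>\<open>'k poly fract\<close> serves both as the field k(x) containing the rational
  functions f and as the base field k(t). The function \<^const>\<open>quot_of_fract\<close> returns a fraction
  in lowest terms.\<close>

definition rf_num :: "'k::field_gcd poly fract \<Rightarrow> 'k poly" where
  "rf_num f = fst (quot_of_fract f)"

definition rf_den :: "'k::field_gcd poly fract \<Rightarrow> 'k poly" where
  "rf_den f = snd (quot_of_fract f)"

definition rf_degree :: "'k::field_gcd poly fract \<Rightarrow> nat" where
  "rf_degree f = max (Polynomial.degree (rf_num f)) (Polynomial.degree (rf_den f))"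

definition rf_const :: "'k::field_gcd \<Rightarrow> 'k poly fract" where
  "rf_const c = to_fract [:c:]"

definition rf_var :: "'k::field_gcd poly fract" where
  "rf_var = to_fract [:0, 1:]"

text \<open>The value of f at a point z of an extension field of k, where h is the embedding of k into
  that field. At a pole of f the value is 0 by the convention on division by zero.\<close>

definition rf_eval :: "('k::field_gcd \<Rightarrow> 'b::field) \<Rightarrow> 'k poly fract \<Rightarrow> 'b \<Rightarrow> 'b" where
  "rf_eval h f z = poly (map_poly h (rf_num f)) z / poly (map_poly h (rf_den f)) z"

definition rf_comp :: "'k::field_gcd poly fract \<Rightarrow> 'k poly fract \<Rightarrow> 'k poly fract" where
  "rf_comp f g = rf_eval rf_const f g"

definition rf_iter :: "'k::field_gcd poly fract \<Rightarrow> nat \<Rightarrow> 'k poly fract" where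
  "rf_iter f n = (rf_comp f ^^ n) rf_var"


section \<open>The tree of iterated preimages of t\<close>

definition ac_const :: "'k::field_gcd \<Rightarrow> 'k poly fract alg_closure" where
  "ac_const c = to_ac (rf_const c)"

text \<open>For nonconstant f, the set of all n-th iterated preimages of t in the projective line over
  the algebraic closure of k(t), that is, the set of roots of \<open>f\<^sup>n(x) - t\<close>: the point at
  infinity and the poles of \<open>f\<^sup>n\<close> (which here evaluate to 0) are not among them, because their
  images are k-rational points, while t is transcendental over k.\<close>

definition rf_level :: "'k::field_gcd poly fract \<Rightarrow> nat \<Rightarrow> 'k poly fract alg_closure set" where
  "rf_level f n = {\<beta>. rf_eval ac_const (rf_iter f n) \<beta> = to_ac rf_var}"

definition tree_vertices :: "'k::field_gcd poly fract \<Rightarrow> 'k poly fract alg_closure set" where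
  "tree_vertices f = (\<Union>n. rf_level f n)"

text \<open>A vertex v of level n+1 is joined to the vertex f(v) of level n.\<close>

definition tree_aut ::
    "'k::field_gcd poly fract \<Rightarrow> ('k poly fract alg_closure \<Rightarrow> 'k poly fract alg_closure) set" where
  "tree_aut f = {g \<in> Bij (tree_vertices f). \<forall>n. g ` rf_level f n = rf_level f n \<and>
     (\<forall>v \<in> rf_level f (Suc n). g (rf_eval ac_const f v) = rf_eval ac_const f (g v))}"


section \<open>The profinite iterated monodromy group\<close>

definition splitting_field :: "'k::field_gcd poly fract \<Rightarrow> nat \<Rightarrow> 'k poly fract alg_closure set" where
  "splitting_field f n = generate_field ring_of_type_algebra (range to_ac \<union> rf_level f n)"

text \<open>Elements of \<^term>\<open>Bij K\<close> are extensional, so distinct functions are distinct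
  automorphisms of K.\<close>

definition galois_group :: "'a::field set \<Rightarrow> 'a set \<Rightarrow> ('a \<Rightarrow> 'a) set" where
  "galois_group K F = {\<sigma> \<in> Bij K.
     (\<forall>x\<in>K. \<forall>y\<in>K. \<sigma> (x + y) = \<sigma> x + \<sigma> y \<and> \<sigma> (x * y) = \<sigma> x * \<sigma> y) \<and> (\<forall>c\<in>F. \<sigma> c = c)}"

definition level_galois_group ::
    "'k::field_gcd poly fract \<Rightarrow> nat \<Rightarrow> ('k poly fract alg_closure \<Rightarrow> 'k poly fract alg_closure) set" where
  "level_galois_group f n = galois_group (splitting_field f n) (range to_ac)"

definition galois_limit ::
    "'k::field_gcd poly fract \<Rightarrow>
      (nat \<Rightarrow> 'k poly fract alg_closure \<Rightarrow> 'k poly fract alg_closure) set" where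
  "galois_limit f = {\<sigma>. \<forall>n. \<sigma> n \<in> level_galois_group f n \<and>
     restrict (\<sigma> (Suc n)) (splitting_field f n) = \<sigma> n}"

text \<open>The image of the inverse limit in the automorphism group of the tree.\<close>

definition img_carrier ::
    "'k::field_gcd poly fract \<Rightarrow> ('k poly fract alg_closure \<Rightarrow> 'k poly fract alg_closure) set" where
  "img_carrier f = {g \<in> tree_aut f. \<exists>\<sigma> \<in> galois_limit f. \<forall>n. \<forall>v \<in> rf_level f n. g v = \<sigma> n v}"

definition img ::
    "'k::field_gcd poly fract \<Rightarrow> ('k poly fract alg_closure \<Rightarrow> 'k poly fract alg_closure) monoid" where
  "img f = BijGroup (tree_vertices f) \<lparr>carrier := img_carrier f\<rparr>"

text \<open>As the levels are finite, the profinite topology on tree automorphisms (the coarsest one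
  for which the restrictions to the first n levels are continuous) is the topology of pointwise
  convergence on the discrete set of vertices.\<close>

definition img_topology ::
    "'k::field_gcd poly fract \<Rightarrow> ('k poly fract alg_closure \<Rightarrow> 'k poly fract alg_closure) topology" where
  "img_topology f = subtopology
     (product_topology (\<lambda>_. discrete_topology (tree_vertices f)) (tree_vertices f)) (img_carrier f)"


section \<open>Haar measure and the fixed-point process\<close>

text \<open>Regularity is not required: it is automatic for the compact metrizable groups considered
  here. For such groups there is exactly one measure as described.\<close>

definition is_haar_prob :: "('a, 'c) monoid_scheme \<Rightarrow> 'a topology \<Rightarrow> 'a measure \<Rightarrow> bool" where
  "is_haar_prob G T M \<longleftrightarrow> prob_space M \<and> space M = carrier G \<and>
     sets M = sigma_sets (carrier G) {U. openin T U} \<and>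
     (\<forall>a \<in> carrier G. \<forall>A \<in> sets M. emeasure M ((\<lambda>x. a \<otimes>\<^bsub>G\<^esub> x) ` A) = emeasure M A)"

definition haar_prob :: "('a, 'c) monoid_scheme \<Rightarrow> 'a topology \<Rightarrow> 'a measure" where
  "haar_prob G T = (THE M. is_haar_prob G T M)"

definition fixed_point_process ::
    "'k::field_gcd poly fract \<Rightarrow> nat \<Rightarrow> ('k poly fract alg_closure \<Rightarrow> 'k poly fract alg_closure) \<Rightarrow> real" where
  "fixed_point_process f n g = real (card {v \<in> rf_level f n. g v = v})"

text \<open>The process is indexed from 1; the value \<^term>\<open>Y 0\<close> is ignored.\<close>

definition is_martingale :: "'a measure \<Rightarrow> (nat \<Rightarrow> 'a \<Rightarrow> real) \<Rightarrow> bool" where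
  "is_martingale M Y \<longleftrightarrow> (\<forall>n\<ge>2. \<forall>t :: nat \<Rightarrow> real.
     let A = {\<omega> \<in> space M. \<forall>i \<in> {1..<n}. Y i \<omega> = t i} in
       measure M A > 0 \<longrightarrow> set_lebesgue_integral M A (Y n) / measure M A = t (n - 1))"

end

theory Submission
  imports Defs
begin

text \<open>The functions used are \<open>f = a S\<^sup>2\<close> with \<open>S = P(x) / (x - 1)\<^sup>r\<close>, where \<open>m = 2r\<close> and
  \<open>P = \<Sum>\<^sub>j (2r choose 2j) x\<^sup>j\<close>. Substituting \<open>x = \<tau>\<^sup>2\<close> and \<open>z = (\<tau> + 1) / (\<tau> - 1)\<close> gives
  \<open>S = (z\<^sup>r + z\<^sup>-\<^sup>r) / 2\<close>. So if v is a root of f(x) = t and \<open>\<zeta>\<^sup>r = -1\<close>, then replacing z by \<open>\<zeta> z\<close> yields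
  another root v', and a square root \<open>\<tau>\<close> of v is a rational expression in v and v' as soon as
  \<open>\<zeta>\<^sup>2 \<noteq> 1\<close>, that is, \<open>r \<ge> 2\<close>. Hence \<open>K\<^sub>1\<close> contains the square roots of all vertices of level 1, and
  since \<open>a S(w)\<^sup>2 = f(w)\<close>, it contains S(w) for every w of level 2. An element of \<open>G(f)\<close> with \<open>Y\<^sub>1 = m\<close> fixes
  \<open>K\<^sub>1\<close>, so it preserves the fibres of S on level 2. There are more such fibres than vertices
  of level 1, because for each such vertex v both square roots of v / a are values of S. By orbit counting, the expectation of
  \<open>Y\<^sub>2\<close> given \<open>Y\<^sub>1 = m\<close> is at least the number of fibres, hence greater than m.\<close>

section \<open>Haar measure on closed permutation groups with finite orbits\<close>

lemma restrict_eq_iff: "restrict g F = restrict h F \<longleftrightarrow> (\<forall>v\<in>F. g v = h v)"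
  by (auto simp: restrict_def fun_eq_iff)

lemma mult_BijGroup: "g \<in> Bij S \<Longrightarrow> h \<in> Bij S \<Longrightarrow> g \<otimes>\<^bsub>BijGroup S\<^esub> h = compose S g h"
  by (simp add: BijGroup_def)

lemma one_BijGroup: "\<one>\<^bsub>BijGroup S\<^esub> = (\<lambda>v\<in>S. v)"
  by (simp add: BijGroup_def)

text \<open>Finite orbits and closedness under pointwise limits make \<open>G\<close> a compact
  group of permutations. Countability of \<open>V\<close> leaves only countably many cylinder sets,
  so that the Borel sets are generated by the clopen ones used below.\<close>

locale closed_perm_group =
  fixes V :: "'a set" and G :: "('a \<Rightarrow> 'a) set"
  assumes countable_V: "countable V"
    and subgroup_G: "subgroup G (BijGroup V)"
    and finite_orbit: "v \<in> V \<Longrightarrow> finite ((\<lambda>g. g v) ` G)"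
    and pointwise_closed: "\<lbrakk>f \<in> extensional V; \<And>F. finite F \<Longrightarrow> F \<subseteq> V \<Longrightarrow> \<exists>g\<in>G. \<forall>v\<in>F. g v = f v\<rbrakk> \<Longrightarrow> f \<in> G"
begin

abbreviation e where "e \<equiv> (\<lambda>v\<in>V. v)"

lemma G_Bij: "G \<subseteq> Bij V"
  using subgroup.subset[OF subgroup_G] by (simp add: BijGroup_def)

lemma G_ext: "g \<in> G \<Longrightarrow> g \<in> extensional V"
  using G_Bij Bij_imp_extensional by blast

lemma G_in: "g \<in> G \<Longrightarrow> v \<in> V \<Longrightarrow> g v \<in> V"
  using G_Bij Bij_imp_funcset by blast

lemma G_eq: "g \<in> G \<Longrightarrow> v \<in> V \<Longrightarrow> w \<in> V \<Longrightarrow> g v = g w \<longleftrightarrow> v = w"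
  using G_Bij by (auto simp: Bij_def bij_betw_def inj_on_def)

lemma one_G: "e \<in> G"
  using subgroup.one_closed[OF subgroup_G] by (simp add: one_BijGroup)

lemma compose_G: "g \<in> G \<Longrightarrow> h \<in> G \<Longrightarrow> compose V g h \<in> G"
  using subgroup.m_closed[OF subgroup_G, of g h] G_Bij by (metis mult_BijGroup subsetD)

lemma inverse_G:
  assumes "g \<in> G"
  obtains h where "h \<in> G" "\<And>v. v \<in> V \<Longrightarrow> h (g v) = v" "\<And>v. v \<in> V \<Longrightarrow> g (h v) = v"
proof
  have B: "g \<in> Bij V" using assms G_Bij by blast
  then have b: "bij_betw g V V" by (simp add: Bij_def)
  let ?h = "\<lambda>x\<in>V. inv_into V g x"
  show "?h \<in> G"
    using subgroup.m_inv_closed[OF subgroup_G assms] inv_BijGroup[OF B] by simp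
  show "?h (g v) = v" "g (?h v) = v" if "v \<in> V" for v
    using that b G_in[OF assms that]
    by (simp_all add: bij_betw_def inv_into_f_f f_inv_into_f)
qed

section \<open>Cosets of stabilizers of finite sets, and the proportion of them in a given
  set\<close>

definition cyl :: "'a set \<Rightarrow> ('a \<Rightarrow> 'a) \<Rightarrow> ('a \<Rightarrow> 'a) set" where
  "cyl F g = {h \<in> G. \<forall>v\<in>F. h v = g v}"

text \<open>Membership in \<open>A\<close> depends only on the values on \<open>F\<close>:
  \<open>A\<close> is a union of left cosets \<open>cyl F g\<close> of the pointwise stabilizer
  \<open>cyl F e\<close>.\<close>

definition invariant :: "'a set \<Rightarrow> ('a \<Rightarrow> 'a) set \<Rightarrow> bool" where
  "invariant F A \<longleftrightarrow> finite F \<and> F \<subseteq> V \<and> A \<subseteq> G \<and> (\<forall>g\<in>A. cyl F g \<subseteq> A)"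

text \<open>The elements of \<open>res F G\<close> label the left cosets of the stabilizer of
  \<open>F\<close>. Counting them stands in for counting in a finite quotient group, even when
  \<open>G\<close> does not map \<open>F\<close> to itself.\<close>

definition res :: "'a set \<Rightarrow> ('a \<Rightarrow> 'a) set \<Rightarrow> ('a \<Rightarrow> 'a) set" where
  "res F A = (\<lambda>g. restrict g F) ` A"

definition clopen_sets :: "('a \<Rightarrow> 'a) set set" where
  "clopen_sets = {A. \<exists>F. invariant F A}"

lemma invariantD: "invariant F A \<Longrightarrow> g \<in> A \<Longrightarrow> h \<in> G \<Longrightarrow> (\<And>v. v \<in> F \<Longrightarrow> h v = g v) \<Longrightarrow> h \<in> A"
  unfolding invariant_def cyl_def by blast

lemma invariantI: "finite F \<Longrightarrow> F \<subseteq> V \<Longrightarrow> A \<subseteq> G \<Longrightarrow>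
    (\<And>g h. g \<in> A \<Longrightarrow> h \<in> G \<Longrightarrow> (\<And>v. v \<in> F \<Longrightarrow> h v = g v) \<Longrightarrow> h \<in> A) \<Longrightarrow> invariant F A"
  unfolding invariant_def cyl_def by blast

lemma invariant_mono: "invariant F A \<Longrightarrow> F \<subseteq> F' \<Longrightarrow> finite F' \<Longrightarrow> F' \<subseteq> V \<Longrightarrow> invariant F' A"
  unfolding invariant_def cyl_def by blast

lemma invariant_G: "finite F \<Longrightarrow> F \<subseteq> V \<Longrightarrow> invariant F G"
  unfolding invariant_def cyl_def by blast

lemma invariant_cyl: "finite F \<Longrightarrow> F \<subseteq> V \<Longrightarrow> invariant F (cyl F g)"
  unfolding invariant_def cyl_def by auto

lemma invariant_common:
  assumes "invariant F A" "invariant F' B"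
  shows "invariant (F \<union> F') A" "invariant (F \<union> F') B"
  by (rule invariant_mono[OF assms(1)] invariant_mono[OF assms(2)];
      use assms in \<open>auto simp: invariant_def\<close>)+

lemma finite_res:
  assumes "invariant F A"
  shows "finite (res F A)"
proof (rule finite_subset)
  show "res F A \<subseteq> PiE F (\<lambda>v. (\<lambda>g. g v) ` G)"
    using assms unfolding res_def invariant_def by (force simp: PiE_def)
  show "finite (PiE F (\<lambda>v. (\<lambda>g. g v) ` G))"
    using assms finite_orbit by (intro finite_PiE) (auto simp: invariant_def)
qed

lemma card_res_G_pos:
  assumes "finite F" "F \<subseteq> V"
  shows "card (res F G) > 0"
  using finite_res[OF invariant_G[OF assms]] one_G by (auto simp: card_gt_0_iff res_def)

lemma res_compose: "g \<in> G \<Longrightarrow> F \<subseteq> V \<Longrightarrow> restrict (compose V g h) F = restrict (\<lambda>v. g (restrict h F v)) F"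
  by (auto simp: restrict_def compose_def fun_eq_iff)

text \<open>Translation by \<open>g\<close> acts on restrictions by composing with \<open>g\<close>
  on the left, which is injective because \<open>g\<close> is.\<close>

lemma card_res_translate:
  assumes "invariant F A" "g \<in> G"
  shows "card (res F (compose V g ` A)) = card (res F A)"
proof -
  have F: "F \<subseteq> V" and A: "A \<subseteq> G" using assms by (auto simp: invariant_def)
  have eq: "res F (compose V g ` A) = (\<lambda>\<phi>. restrict (\<lambda>v. g (\<phi> v)) F) ` res F A"
    unfolding res_def image_image by (intro image_cong refl res_compose assms F)
  have "inj_on (\<lambda>\<phi>. restrict (\<lambda>v. g (\<phi> v)) F) (res F A)"
  proof (rule inj_onI)
    fix \<phi> \<psi> assume "\<phi> \<in> res F A" "\<psi> \<in> res F A" and eq: "restrict (\<lambda>v. g (\<phi> v)) F = restrict (\<lambda>v. g (\<psi> v)) F"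
    then obtain a b where ab: "a \<in> G" "b \<in> G" "\<phi> = restrict a F" "\<psi> = restrict b F"
      using A by (auto simp: res_def)
    have "a v = b v" if "v \<in> F" for v
    proof -
      have "g (a v) = g (b v)"
        using eq that ab unfolding restrict_eq_iff by simp
      then show ?thesis
        using G_eq[OF assms(2)] G_in ab that F by blast
    qed
    then show "\<phi> = \<psi>" by (simp add: ab restrict_eq_iff)
  qed
  then show ?thesis unfolding eq by (rule card_image)
qed

lemma translate_cyl:
  assumes "g \<in> G" "F \<subseteq> V"
  shows "compose V g ` cyl F e = cyl F g"
proof (intro equalityI subsetI)
  fix h assume "h \<in> compose V g ` cyl F e"
  then show "h \<in> cyl F g"
    using assms compose_G by (auto simp: cyl_def compose_def subset_iff)
next
  fix h assume h: "h \<in> cyl F g"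
  obtain k where k: "k \<in> G" "\<And>v. v \<in> V \<Longrightarrow> k (g v) = v" "\<And>v. v \<in> V \<Longrightarrow> g (k v) = v"
    using inverse_G[OF assms(1)] by metis
  have hG: "h \<in> G" using h by (simp add: cyl_def)
  have "compose V k h \<in> cyl F e"
    using h k compose_G[OF k(1) hG] assms(2) by (auto simp: cyl_def compose_def subset_iff)
  moreover have "compose V g (compose V k h) = h"
    using k hG G_ext[OF hG] G_in[OF hG] by (auto simp: compose_def extensional_def fun_eq_iff)
  ultimately show "h \<in> compose V g ` cyl F e" by (metis imageI)
qed

text \<open>Every restriction to \<open>F\<close> of an element of \<open>A\<close> extends to
  \<open>F'\<close> in equally many ways: the extensions belonging to \<open>g\<close> are the
  translates by \<open>g\<close> of those belonging to the identity.\<close>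

lemma card_res_mono:
  assumes "invariant F A" "F \<subseteq> F'" "finite F'" "F' \<subseteq> V"
  shows "card (res F' A) = card (res F A) * card (res F' (cyl F e))"
proof -
  have F: "finite F" "F \<subseteq> V" and A: "A \<subseteq> G" using assms by (auto simp: invariant_def)
  have inv': "invariant F' A" using invariant_mono assms by blast
  have fin: "finite (res F' A)" by (rule finite_res[OF inv'])
  have img: "(\<lambda>\<phi>. restrict \<phi> F) ` res F' A = res F A"
    unfolding res_def image_image using assms(2) by (intro image_cong refl) (auto simp: restrict_def fun_eq_iff)
  have fib: "card {\<phi> \<in> res F' A. restrict \<phi> F = \<psi>} = card (res F' (cyl F e))" if psi: "\<psi> \<in> res F A" for \<psi>
  proof -
    obtain g where g: "g \<in> A" "\<psi> = restrict g F" using psi unfolding res_def by blast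
    have gG: "g \<in> G" using g A by blast
    have "{\<phi> \<in> res F' A. restrict \<phi> F = \<psi>} = res F' (cyl F g)"
    proof (intro equalityI subsetI)
      fix \<phi> assume "\<phi> \<in> {\<phi> \<in> res F' A. restrict \<phi> F = \<psi>}"
      then obtain h where h: "h \<in> A" "\<phi> = restrict h F'" "restrict (restrict h F') F = restrict g F"
        using g by (auto simp: res_def)
      have "\<forall>v\<in>F. h v = g v" using h(3) assms(2) unfolding restrict_eq_iff by (metis restrict_apply' subsetD)
      then show "\<phi> \<in> res F' (cyl F g)" using h A by (auto simp: res_def cyl_def)
    next
      fix \<phi> assume "\<phi> \<in> res F' (cyl F g)"
      then obtain h where h: "h \<in> cyl F g" "\<phi> = restrict h F'" by (auto simp: res_def)
      have "h \<in> A" using assms(1) g(1) h(1) by (auto simp: invariant_def)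
      moreover have "restrict \<phi> F = \<psi>" using h g(2) assms(2) by (simp add: cyl_def Int_absorb1 restrict_eq_iff)
      ultimately show "\<phi> \<in> {\<phi> \<in> res F' A. restrict \<phi> F = \<psi>}" using h(2) by (auto simp: res_def)
    qed
    also have "cyl F g = compose V g ` cyl F e"
      using translate_cyl[OF gG F(2)] by simp
    also have "card (res F' \<dots>) = card (res F' (cyl F e))"
      by (rule card_res_translate[OF _ gG]) (use invariant_mono[OF invariant_cyl[OF F] assms(2-4)] in simp)
    finally show ?thesis .
  qed
  have "card (res F' A) = (\<Sum>\<phi>\<in>res F' A. 1)" by simp
  also have "\<dots> = (\<Sum>\<psi>\<in>(\<lambda>\<phi>. restrict \<phi> F) ` res F' A. \<Sum>\<phi>\<in>{\<phi> \<in> res F' A. restrict \<phi> F = \<psi>}. 1)"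
    by (rule sum.image_gen[OF fin])
  also have "\<dots> = (\<Sum>\<psi>\<in>res F A. card {\<phi> \<in> res F' A. restrict \<phi> F = \<psi>})"
    unfolding img by simp
  also have "\<dots> = (\<Sum>\<psi>\<in>res F A. card (res F' (cyl F e)))"
    using fib by (intro sum.cong refl) auto
  finally show ?thesis by simp
qed

definition density :: "'a set \<Rightarrow> ('a \<Rightarrow> 'a) set \<Rightarrow> real" where
  "density F A = real (card (res F A)) / real (card (res F G))"

text \<open>By \<open>card_res_mono\<close>, numerator and denominator grow by the same nonzero
  factor.\<close>

lemma density_mono:
  assumes "invariant F A" "F \<subseteq> F'" "finite F'" "F' \<subseteq> V"
  shows "density F' A = density F A"
proof -
  have F: "finite F" "F \<subseteq> V" using assms by (auto simp: invariant_def)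
  have "e \<in> cyl F e" using one_G by (simp add: cyl_def)
  then have "card (res F' (cyl F e)) \<noteq> 0"
    using finite_res[OF invariant_mono[OF invariant_cyl[OF F] assms(2-4)]] by (auto simp: res_def)
  then show ?thesis
    unfolding density_def card_res_mono[OF assms] card_res_mono[OF invariant_G[OF F] assms(2-4)] by simp
qed

lemma density_indep: "invariant F A \<Longrightarrow> invariant F' A \<Longrightarrow> density F A = density F' A"
  by (metis (no_types, lifting) Un_upper1 Un_upper2 density_mono finite_Un invariant_def le_sup_iff)

text \<open>The choice of \<open>F\<close> is immaterial by \<open>density_indep\<close>, which
  compares two candidates with their union.\<close>

definition content :: "('a \<Rightarrow> 'a) set \<Rightarrow> real" where
  "content A = density (SOME F. invariant F A) A"

lemma content_eq: "invariant F A \<Longrightarrow> content A = density F A"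
  unfolding content_def by (metis density_indep someI)

lemma content_nonneg: "content A \<ge> 0"
  by (simp add: content_def density_def)

lemma invariant_empty: "invariant {} {}"
  by (simp add: invariant_def)

lemma content_empty: "content {} = 0"
  using content_eq[OF invariant_empty] by (simp add: density_def res_def)

lemma content_G: "content G = 1"
  using content_eq[OF invariant_G[of "{}"]] card_res_G_pos[of "{}"] by (simp add: density_def)

lemma content_Un:
  assumes "A \<in> clopen_sets" "B \<in> clopen_sets" "A \<inter> B = {}"
  shows "content (A \<union> B) = content A + content B"
proof -
  obtain F F' where "invariant F A" "invariant F' B" using assms by (auto simp: clopen_sets_def)
  then have A: "invariant (F \<union> F') A" and B: "invariant (F \<union> F') B" using invariant_common by blast+
  then have AB: "invariant (F \<union> F') (A \<union> B)" by (auto simp: invariant_def)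
  have "res (F \<union> F') A \<inter> res (F \<union> F') B = {}"
  proof (rule ccontr)
    assume "res (F \<union> F') A \<inter> res (F \<union> F') B \<noteq> {}"
    then obtain a b where "a \<in> A" "b \<in> B" "restrict a (F \<union> F') = restrict b (F \<union> F')"
      unfolding res_def by (auto; metis)
    moreover have "b \<in> G" using B \<open>b \<in> B\<close> by (auto simp: invariant_def)
    ultimately have "b \<in> A" using invariantD[OF A \<open>a \<in> A\<close> \<open>b \<in> G\<close>] unfolding restrict_eq_iff by metis
    then show False using \<open>b \<in> B\<close> assms(3) by blast
  qed
  then have "card (res (F \<union> F') (A \<union> B)) = card (res (F \<union> F') A) + card (res (F \<union> F') B)"
    using finite_res[OF A] finite_res[OF B] by (simp add: res_def image_Un card_Un_disjoint)
  then show ?thesis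
    using content_eq[OF A] content_eq[OF B] content_eq[OF AB] by (simp add: density_def add_divide_distrib)
qed

lemma algebra_clopen: "Sigma_Algebra.algebra G clopen_sets"
  unfolding algebra_iff_Un
proof (intro conjI ballI)
  show "clopen_sets \<subseteq> Pow G" "{} \<in> clopen_sets"
    using invariant_empty by (auto simp: clopen_sets_def invariant_def)
next
  fix A assume "A \<in> clopen_sets"
  then obtain F where F: "invariant F A" by (auto simp: clopen_sets_def)
  have "invariant F (G - A)"
  proof (rule invariantI)
    fix g h assume gh: "g \<in> G - A" "h \<in> G" "\<And>v. v \<in> F \<Longrightarrow> h v = g v"
    then have "h \<notin> A" using invariantD[OF F, of h g] by auto
    then show "h \<in> G - A" using gh by blast
  qed (use F in \<open>auto simp: invariant_def\<close>)
  then show "G - A \<in> clopen_sets" by (auto simp: clopen_sets_def)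
next
  fix A B assume "A \<in> clopen_sets" "B \<in> clopen_sets"
  then obtain F F' where "invariant F A" "invariant F' B" by (auto simp: clopen_sets_def)
  then have A: "invariant (F \<union> F') A" and B: "invariant (F \<union> F') B" using invariant_common by blast+
  then have "invariant (F \<union> F') (A \<union> B)" by (auto simp: invariant_def)
  then show "A \<union> B \<in> clopen_sets" by (auto simp: clopen_sets_def)
qed

section \<open>The profinite topology, its compactness and its Borel sets\<close>

abbreviation P :: "('a \<Rightarrow> 'a) topology" where "P \<equiv> product_topology (\<lambda>_. discrete_topology V) V"
abbreviation T :: "('a \<Rightarrow> 'a) topology" where "T \<equiv> subtopology P G"

lemma G_subset_PiE: "G \<subseteq> PiE V (\<lambda>_. V)"
  using G_ext G_in by (auto simp: PiE_def)

lemma topspace_T: "topspace T = G"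
  using G_subset_PiE by auto

lemma openin_P_cyl:
  assumes "finite F" "F \<subseteq> V"
  shows "openin P {h \<in> PiE V (\<lambda>_. V). \<forall>v\<in>F. h v = g v}"
  unfolding openin_product_topology_alt
proof (intro conjI ballI)
  fix h assume h: "h \<in> {h \<in> PiE V (\<lambda>_. V). \<forall>v\<in>F. h v = g v}"
  \<comment> \<open>Prescribing the values on \<open>F\<close> and leaving the other coordinates
    free gives a basic open set of the product.\<close>
  let ?U = "\<lambda>v. if v \<in> F then {g v} else V"
  have "{i \<in> V. ?U i \<noteq> topspace (discrete_topology V)} \<subseteq> F" by auto
  then have "finite {i \<in> V. ?U i \<noteq> topspace (discrete_topology V)}"
    using assms(1) finite_subset by blast
  moreover have "\<forall>i\<in>V. openin (discrete_topology V) (?U i)"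
    using h assms(2) by (auto simp: PiE_iff)
  moreover have "h \<in> PiE V ?U" using h by (auto simp: PiE_iff)
  moreover have "PiE V ?U \<subseteq> {h \<in> PiE V (\<lambda>_. V). \<forall>v\<in>F. h v = g v}"
  proof
    fix k assume k: "k \<in> PiE V ?U"
    have F: "k v = g v" if "v \<in> F" for v
      using PiE_mem[OF k, of v] that assms(2) by auto
    have "k v \<in> V" if "v \<in> V" for v
      using PiE_mem[OF k that] PiE_mem[of h V "\<lambda>_. V" v] h that F by (cases "v \<in> F") auto
    then show "k \<in> {h \<in> PiE V (\<lambda>_. V). \<forall>v\<in>F. h v = g v}"
      using k F by (simp add: PiE_iff)
  qed
  ultimately show "\<exists>U. finite {i \<in> V. U i \<noteq> topspace (discrete_topology V)} \<and>
      (\<forall>i\<in>V. openin (discrete_topology V) (U i)) \<and> h \<in> Pi\<^sub>E V U \<and>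
      Pi\<^sub>E V U \<subseteq> {h \<in> PiE V (\<lambda>_. V). \<forall>v\<in>F. h v = g v}"
    by (intro exI[of _ ?U] conjI)
qed

lemma openin_T_cyl:
  assumes "finite F" "F \<subseteq> V"
  shows "openin T (cyl F g)"
proof -
  have "cyl F g = {h \<in> PiE V (\<lambda>_. V). \<forall>v\<in>F. h v = g v} \<inter> G"
    using G_subset_PiE by (auto simp: cyl_def)
  with openin_P_cyl[OF assms] show ?thesis unfolding openin_subtopology by (intro exI conjI)
qed

lemma openin_T_clopen:
  assumes "A \<in> clopen_sets"
  shows "openin T A"
proof -
  obtain F where F: "invariant F A" using assms by (auto simp: clopen_sets_def)
  then have "A = (\<Union>g\<in>A. cyl F g)" by (auto simp: invariant_def cyl_def)
  moreover have "openin T (\<Union>g\<in>A. cyl F g)"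
    using F openin_T_cyl by (intro openin_Union) (auto simp: invariant_def)
  ultimately show ?thesis by simp
qed

text \<open>A basic open set of the product restricts only finitely many coordinates; these serve as
  \<open>F\<close>.\<close>

lemma openin_T_imp_cyl:
  assumes "openin T U" "g \<in> U"
  obtains F where "finite F" "F \<subseteq> V" "cyl F g \<subseteq> U"
proof -
  obtain W where W: "openin P W" "U = W \<inter> G" using assms by (auto simp: openin_subtopology)
  have "g \<in> W" using assms(2) W(2) by blast
  with W(1)[unfolded openin_product_topology_alt]
  have "\<exists>D. finite {i \<in> V. D i \<noteq> topspace (discrete_topology V)} \<and>
      (\<forall>i\<in>V. openin (discrete_topology V) (D i)) \<and> g \<in> Pi\<^sub>E V D \<and> Pi\<^sub>E V D \<subseteq> W"
    by (rule bspec)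
  then obtain D where D: "finite {i \<in> V. D i \<noteq> topspace (discrete_topology V)}" "g \<in> Pi\<^sub>E V D" "Pi\<^sub>E V D \<subseteq> W"
    by (elim exE conjE)
  show ?thesis
  proof (rule that[OF D(1)])
    show "cyl {i \<in> V. D i \<noteq> topspace (discrete_topology V)} g \<subseteq> U"
    proof
      fix h assume h: "h \<in> cyl {i \<in> V. D i \<noteq> topspace (discrete_topology V)} g"
      then have hG: "h \<in> G" by (simp add: cyl_def)
      have "h v \<in> D v" if "v \<in> V" for v
      proof (cases "D v = V")
        case True then show ?thesis using G_in hG that by blast
      next
        case False
        then have "h v = g v" using h that by (simp add: cyl_def)
        then show ?thesis using D(2) that by (auto simp: PiE_iff)
      qed
      then have "h \<in> Pi\<^sub>E V D" using G_ext[OF hG] by (auto simp: PiE_iff)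
      then show "h \<in> U" using D(3) W hG by blast
    qed
  qed auto
qed

text \<open>\<open>G\<close> is closed in \<open>P\<close> by \<open>pointwise_closed\<close>, and
  it lies in the product of its orbits, which is compact because the orbits are finite.\<close>

lemma compact_space_T: "compact_space T"
proof -
  let ?K = "PiE V (\<lambda>v. (\<lambda>g. g v) ` G)"
  have "compactin P ?K"
    unfolding compactin_PiE using finite_orbit G_in by (auto simp: compactin_discrete_topology)
  moreover have "G \<subseteq> ?K" by (simp add: subset_iff PiE_iff G_ext)
  moreover have "closedin P G"
  proof -
    have "P closure_of G \<subseteq> G"
    proof
      fix f assume f: "f \<in> P closure_of G"
      then have fP: "f \<in> PiE V (\<lambda>_. V)" by (simp add: in_closure_of)
      show "f \<in> G"
      proof (rule pointwise_closed)
        show "f \<in> extensional V" using fP by (simp add: PiE_iff)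
        fix F assume "finite F" "F \<subseteq> V"
        then have "openin P {h \<in> PiE V (\<lambda>_. V). \<forall>v\<in>F. h v = f v}" by (rule openin_P_cyl)
        moreover have "\<forall>W. f \<in> W \<and> openin P W \<longrightarrow> (\<exists>y. y \<in> G \<and> y \<in> W)"
          using f unfolding in_closure_of by (rule conjunct2)
        ultimately have "\<exists>y. y \<in> G \<and> y \<in> {h \<in> PiE V (\<lambda>_. V). \<forall>v\<in>F. h v = f v}"
          using fP by (elim allE[of _ "{h \<in> PiE V (\<lambda>_. V). \<forall>v\<in>F. h v = f v}"]) simp
        then show "\<exists>g\<in>G. \<forall>v\<in>F. g v = f v" by auto
      qed
    qed
    moreover have "G \<subseteq> P closure_of G"
      using G_subset_PiE by (intro closure_of_subset) simp
    ultimately show ?thesis by (metis closedin_closure_of subset_antisym)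
  qed
  ultimately have "compactin P G" by (rule closed_compactin)
  then show ?thesis by (simp add: compactin_subspace)
qed

text \<open>Clopen sets are closed in a compact space, so the finite intersection property applies.
  This is the source of countable additivity for \<open>content\<close>.\<close>

lemma clopen_nested_empty:
  assumes "range A \<subseteq> clopen_sets" "decseq A" "(\<Inter>i. A i) = {}"
  shows "\<exists>i::nat. A i = {}"
proof (rule ccontr)
  assume ne: "\<nexists>i. A i = {}"
  have closed: "\<forall>C\<in>range A. closedin T C"
  proof
    fix C assume "C \<in> range A"
    then have C: "C \<in> clopen_sets" using assms(1) by blast
    then have "G - C \<in> clopen_sets" "C \<subseteq> G"
      using algebra_clopen unfolding algebra_iff_Un by blast+
    then show "closedin T C" using openin_T_clopen topspace_T by (simp add: closedin_def)
  qed
  have "\<Inter>K \<noteq> {}" if fin: "finite K" and sub: "K \<subseteq> range A" for K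
  proof -
    obtain I where I: "finite I" "K = A ` I" using finite_subset_image[OF fin sub] by auto
    obtain n where n: "\<forall>i\<in>I. i \<le> n" using I(1) finite_nat_set_iff_bounded_le by blast
    then have "A n \<subseteq> \<Inter>K" using I(2) assms(2) by (auto simp: decseq_def)
    then show ?thesis using ne by blast
  qed
  then have fip: "\<forall>K. finite K \<and> K \<subseteq> range A \<longrightarrow> \<Inter>K \<noteq> {}" by blast
  have "\<Inter>(range A) \<noteq> {}"
    by (rule mp[OF spec[OF compact_space_fip[THEN iffD1, OF compact_space_T]]]) (intro conjI closed fip)
  then show False using assms(3) by simp
qed

text \<open>There are countably many finite \<open>F\<close>, each with finitely many cosets, hence
  countably many cylinders in all. So every open set is a countable union of clopen sets.\<close>

lemma sigma_open_eq: "sigma_sets G {U. openin T U} = sigma_sets G clopen_sets"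
proof (rule sigma_sets_eqI)
  fix U assume "U \<in> {U. openin T U}"
  then have U: "openin T U" by simp
  define E where "E = {C. \<exists>F g. finite F \<and> F \<subseteq> V \<and> g \<in> G \<and> C = cyl F g}"
  have "countable E"
  proof -
    have "E \<subseteq> (\<Union>F\<in>{F. finite F \<and> F \<subseteq> V}. (\<lambda>\<phi>. cyl F \<phi>) ` res F G)"
    proof
      fix C assume "C \<in> E"
      then obtain F g where C: "finite F" "F \<subseteq> V" "g \<in> G" "C = cyl F g" by (auto simp: E_def)
      then have "C = cyl F (restrict g F)" by (simp add: cyl_def)
      then show "C \<in> (\<Union>F\<in>{F. finite F \<and> F \<subseteq> V}. (\<lambda>\<phi>. cyl F \<phi>) ` res F G)"
        using C by (auto simp: res_def)
    qed
    moreover have "countable {F. finite F \<and> F \<subseteq> V}"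
      using countable_Collect_finite_subset[OF countable_V] by (simp add: conj_commute)
    then have "countable (\<Union>F\<in>{F. finite F \<and> F \<subseteq> V}. (\<lambda>\<phi>. cyl F \<phi>) ` res F G)"
      using finite_res[OF invariant_G] by (intro countable_UN) (auto intro!: countable_finite)
    ultimately show ?thesis using countable_subset by blast
  qed
  have "U = \<Union>{C \<in> E. C \<subseteq> U}"
  proof (intro equalityI subsetI)
    fix g assume g: "g \<in> U"
    obtain F where F: "finite F" "F \<subseteq> V" "cyl F g \<subseteq> U" using openin_T_imp_cyl[OF U g] .
    have "g \<in> G" using openin_subset[OF U] g topspace_T by blast
    then have "g \<in> cyl F g" "cyl F g \<in> E" using F by (auto simp: cyl_def E_def)
    then show "g \<in> \<Union>{C \<in> E. C \<subseteq> U}" using F by blast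
  qed auto
  moreover have "\<Union>{C \<in> E. C \<subseteq> U} \<in> sigma_sets G clopen_sets"
  proof (rule sigma_sets_UNION)
    show "countable {C \<in> E. C \<subseteq> U}" using \<open>countable E\<close> by (rule countable_subset[rotated]) auto
    show "b \<in> sigma_sets G clopen_sets" if "b \<in> {C \<in> E. C \<subseteq> U}" for b
      using that invariant_cyl by (auto simp: E_def clopen_sets_def intro!: sigma_sets.Basic)
  qed
  ultimately show "U \<in> sigma_sets G clopen_sets" by simp
next
  fix A assume "A \<in> clopen_sets"
  then show "A \<in> sigma_sets G {U. openin T U}" using openin_T_clopen by (auto intro: sigma_sets.Basic)
qed

end

section \<open>Existence and uniqueness of the Haar measure\<close>

context closed_perm_group begin

abbreviation H where "H \<equiv> BijGroup V \<lparr>carrier := G\<rparr>"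

lemma mult_H: "g \<in> G \<Longrightarrow> h \<in> G \<Longrightarrow> g \<otimes>\<^bsub>H\<^esub> h = compose V g h"
  using G_Bij by (simp add: BijGroup_def subset_iff)

lemma translate_eq: "g \<in> G \<Longrightarrow> A \<subseteq> G \<Longrightarrow> (\<lambda>x. g \<otimes>\<^bsub>H\<^esub> x) ` A = compose V g ` A"
  by (intro image_cong refl mult_H) auto

lemma is_haar_prob_iff:
  "is_haar_prob H T M \<longleftrightarrow> prob_space M \<and> space M = G \<and> sets M = sigma_sets G clopen_sets \<and>
     (\<forall>g\<in>G. \<forall>A\<in>sets M. emeasure M (compose V g ` A) = emeasure M A)"
proof -
  have "(\<forall>g\<in>G. \<forall>A\<in>sets M. emeasure M ((\<lambda>x. g \<otimes>\<^bsub>H\<^esub> x) ` A) = emeasure M A) \<longleftrightarrow>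
     (\<forall>g\<in>G. \<forall>A\<in>sets M. emeasure M (compose V g ` A) = emeasure M A)" if "space M = G"
  proof (intro ball_cong refl)
    fix g A assume "g \<in> G" "A \<in> sets M"
    then show "(emeasure M ((\<lambda>x. g \<otimes>\<^bsub>H\<^esub> x) ` A) = emeasure M A) = (emeasure M (compose V g ` A) = emeasure M A)"
      using translate_eq[of g A] sets.sets_into_space[of A M] that by simp
  qed
  then show ?thesis unfolding is_haar_prob_def sigma_open_eq[symmetric] by auto
qed

text \<open>Invariance gives all cosets of the stabilizer of \<open>F\<close> the same mass, and
  \<open>A\<close> is a disjoint union of \<open>card (res F A)\<close> of them.\<close>

lemma haar_measure_invariant:
  assumes M: "is_haar_prob H T M" and A: "invariant F A"
  shows "measure M A = density F A"
proof -
  interpret prob_space M using M by (simp add: is_haar_prob_def)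
  have F: "finite F" "F \<subseteq> V" using A by (auto simp: invariant_def)
  have sp: "space M = G" and st: "sets M = sigma_sets G clopen_sets"
    and inv: "\<And>g B. g \<in> G \<Longrightarrow> B \<in> sets M \<Longrightarrow> emeasure M (compose V g ` B) = emeasure M B"
    using M unfolding is_haar_prob_iff by auto
  have cyl_sets: "cyl F g \<in> sets M" for g
    unfolding st using invariant_cyl[OF F] by (auto simp: clopen_sets_def intro!: sigma_sets.Basic)
  have *: "measure M B = card (res F B) * measure M (cyl F e)" if B: "invariant F B" for B
  proof -
    have cyl_eq: "measure M (cyl F \<phi>) = measure M (cyl F e)" if "\<phi> \<in> res F B" for \<phi>
    proof -
      obtain g where g: "g \<in> G" "\<phi> = restrict g F"
        using \<open>\<phi> \<in> res F B\<close> B unfolding res_def invariant_def by blast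
      then have "cyl F \<phi> = compose V g ` cyl F e"
        using translate_cyl[OF g(1) F(2)] by (simp add: cyl_def)
      then show ?thesis using inv[OF g(1) cyl_sets[of e]] by (simp add: measure_def)
    qed
    have "B = (\<Union>\<phi>\<in>res F B. cyl F \<phi>)"
    proof (intro equalityI subsetI)
      fix g assume "g \<in> B"
      then show "g \<in> (\<Union>\<phi>\<in>res F B. cyl F \<phi>)" using B by (auto simp: res_def cyl_def invariant_def)
    next
      fix h assume "h \<in> (\<Union>\<phi>\<in>res F B. cyl F \<phi>)"
      then obtain g where "g \<in> B" "h \<in> cyl F (restrict g F)" by (auto simp: res_def)
      then show "h \<in> B" using invariantD[OF B, of g h] by (simp add: cyl_def)
    qed
    then have "measure M B = measure M (\<Union>\<phi>\<in>res F B. cyl F \<phi>)" by simp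
    also have "\<dots> = (\<Sum>\<phi>\<in>res F B. measure M (cyl F \<phi>))"
    proof (rule finite_measure_finite_Union)
      show "disjoint_family_on (cyl F) (res F B)"
        unfolding disjoint_family_on_def
      proof (intro ballI impI equals0I)
        fix \<phi> \<psi> h assume "\<phi> \<in> res F B" "\<psi> \<in> res F B" "\<phi> \<noteq> \<psi>" "h \<in> cyl F \<phi> \<inter> cyl F \<psi>"
        moreover from this have "\<phi> = restrict \<phi> F" "\<psi> = restrict \<psi> F" by (auto simp: res_def)
        ultimately show False by (auto simp: cyl_def) (metis restrict_eq_iff)
      qed
    qed (use finite_res[OF B] cyl_sets in auto)
    also have "\<dots> = card (res F B) * measure M (cyl F e)"
      using cyl_eq by simp
    finally show ?thesis .
  qed
  \<comment> \<open>The case \<open>B = G\<close> determines the common mass of the cosets.\<close>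
  have "1 = card (res F G) * measure M (cyl F e)"
    using *[OF invariant_G[OF F]] prob_space sp by simp
  then have "measure M (cyl F e) = 1 / card (res F G)"
    using card_res_G_pos[OF F] by (simp add: field_simps)
  then show ?thesis using *[OF A] by (simp add: density_def)
qed

lemma Int_stable_clopen: "Int_stable clopen_sets"
proof -
  interpret A: Sigma_Algebra.algebra G clopen_sets by (rule algebra_clopen)
  show ?thesis unfolding Int_stable_def by blast
qed

lemma clopen_sets_Pow: "clopen_sets \<subseteq> Pow G"
  by (auto simp: clopen_sets_def invariant_def)

lemma G_clopen: "G \<in> clopen_sets"
  using invariant_G[of "{}"] by (auto simp: clopen_sets_def)

text \<open>By \<open>haar_measure_invariant\<close>, two Haar measures agree on the clopen sets, a
  generator stable under intersection.\<close>

lemma haar_prob_unique: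
  assumes "is_haar_prob H T M" "is_haar_prob H T N"
  shows "M = N"
proof (rule measure_eqI_generator_eq[OF Int_stable_clopen clopen_sets_Pow])
  interpret M: prob_space M using assms by (simp add: is_haar_prob_def)
  interpret N: prob_space N using assms by (simp add: is_haar_prob_def)
  show "sets M = sigma_sets G clopen_sets" "sets N = sigma_sets G clopen_sets"
    using assms unfolding is_haar_prob_iff by auto
  show "emeasure M A = emeasure N A" if "A \<in> clopen_sets" for A
    using that haar_measure_invariant[OF assms(1)] haar_measure_invariant[OF assms(2)]
    by (auto simp: clopen_sets_def M.emeasure_eq_measure N.emeasure_eq_measure)
  show "range (\<lambda>i::nat. G) \<subseteq> clopen_sets" "(\<Union>i::nat. G) = G" using G_clopen by auto
  show "emeasure M G \<noteq> \<infinity>" for i :: nat by (simp add: M.emeasure_eq_measure)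
qed

text \<open>In the product \<open>compose V g h\<close> the factor \<open>h\<close> acts first, so
  its values on \<open>F\<close> depend only on those of \<open>h\<close> on \<open>F\<close>, and
  the same \<open>F\<close> serves again.\<close>

lemma invariant_vimage:
  assumes "invariant F A" "g \<in> G"
  shows "invariant F {h \<in> G. compose V g h \<in> A}"
proof (rule invariantI)
  fix h k assume hk: "h \<in> {h \<in> G. compose V g h \<in> A}" "k \<in> G" "\<And>v. v \<in> F \<Longrightarrow> k v = h v"
  have "compose V g k v = compose V g h v" if "v \<in> F" for v
    using hk(3)[OF that] by (simp add: compose_def)
  then have "compose V g k \<in> A"
    using invariantD[OF assms(1), of "compose V g h" "compose V g k"] hk compose_G assms(2) by blast
  then show "k \<in> {h \<in> G. compose V g h \<in> A}" using hk by blast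
qed (use assms in \<open>auto simp: invariant_def\<close>)

lemma vimage_translate:
  assumes "g \<in> G" "A \<subseteq> G"
  shows "compose V g ` {h \<in> G. compose V g h \<in> A} = A"
proof (intro equalityI subsetI)
  fix h assume h: "h \<in> A"
  obtain k where k: "k \<in> G" "\<And>v. v \<in> V \<Longrightarrow> k (g v) = v" "\<And>v. v \<in> V \<Longrightarrow> g (k v) = v"
    using inverse_G[OF assms(1)] by metis
  have hG: "h \<in> G" using h assms by blast
  have "compose V g (compose V k h) = h"
    using k hG G_ext[OF hG] G_in[OF hG] by (auto simp: compose_def extensional_def fun_eq_iff)
  moreover have "compose V k h \<in> G" using k hG compose_G by blast
  ultimately show "h \<in> compose V g ` {h \<in> G. compose V g h \<in> A}"
    using h by (metis (mono_tags, lifting) imageI mem_Collect_eq)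
qed auto

lemma content_vimage:
  assumes "A \<in> clopen_sets" "g \<in> G"
  shows "content {h \<in> G. compose V g h \<in> A} = content A"
proof -
  obtain F where F: "invariant F A" using assms by (auto simp: clopen_sets_def)
  then have "A \<subseteq> G" by (auto simp: invariant_def)
  then show ?thesis
    using content_eq[OF F] content_eq[OF invariant_vimage[OF F assms(2)]]
      card_res_translate[OF invariant_vimage[OF F assms(2)] assms(2)] vimage_translate[OF assms(2)]
    by (simp add: density_def)
qed

text \<open>Caratheodory extension of \<open>content\<close>; invariance is then transferred from
  the clopen sets to all Borel sets.\<close>

lemma haar_prob_exists: "\<exists>M. is_haar_prob H T M"
proof -
  interpret A: Sigma_Algebra.algebra G clopen_sets by (rule algebra_clopen)
  have "\<exists>\<mu> :: ('a \<Rightarrow> 'a) set \<Rightarrow> ennreal. (\<forall>s \<in> clopen_sets. \<mu> s = ennreal (content s)) \<and>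
      measure_space G (sigma_sets G clopen_sets) \<mu>"
  proof (rule A.caratheodory_empty_continuous)
    show "positive clopen_sets (\<lambda>A. ennreal (content A))"
      by (simp add: positive_def content_empty)
    show "additive clopen_sets (\<lambda>A. ennreal (content A))"
      by (simp add: additive_def content_Un content_nonneg)
    fix A :: "nat \<Rightarrow> ('a \<Rightarrow> 'a) set"
    assume A: "range A \<subseteq> clopen_sets" "decseq A" "(\<Inter>i. A i) = {}"
    then obtain n where n: "A n = {}" using clopen_nested_empty by blast
    \<comment> \<open>By compactness the sequence is eventually empty, so continuity at the empty
      set holds trivially.\<close>
    have "A i = {}" if "i \<ge> n" for i using A(2) n that by (auto simp: decseq_def)
    then have "eventually (\<lambda>i. ennreal (content (A i)) = 0) sequentially"
      by (auto simp: eventually_sequentially content_empty intro!: exI[of _ n])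
    then show "(\<lambda>i. ennreal (content (A i))) \<longlonglongrightarrow> 0" by (simp add: tendsto_eventually)
  qed auto
  then obtain \<mu> :: "('a \<Rightarrow> 'a) set \<Rightarrow> ennreal" where \<mu>: "\<And>s. s \<in> clopen_sets \<Longrightarrow> \<mu> s = ennreal (content s)"
    and ms: "measure_space G (sigma_sets G clopen_sets) \<mu>" by blast
  define M where "M = measure_of G (sigma_sets G clopen_sets) \<mu>"
  have sa: "sigma_algebra G (sigma_sets G clopen_sets)"
    using ms by (simp add: measure_space_def)
  have sp: "space M = G"
    using sigma_algebra.space_measure_of_eq[OF sa] by (simp add: M_def)
  have st: "sets M = sigma_sets G clopen_sets"
    using sigma_algebra.sets_measure_of_eq[OF sa] by (simp add: M_def)
  have em: "emeasure M A = ennreal (content A)" if "A \<in> clopen_sets" for A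
    unfolding M_def using ms that \<mu>
    by (subst emeasure_measure_of_sigma) (auto simp: measure_space_def)
  interpret prob_space M
    by (rule prob_spaceI) (simp add: sp em[OF G_clopen] content_G)
  have clopen_meas: "A \<in> sets M" if "A \<in> clopen_sets" for A
    using that st by (auto intro: sigma_sets.Basic)
  have tr_meas: "compose V g \<in> measurable M M" if g: "g \<in> G" for g
  proof (rule measurable_sigma_sets[OF st])
    show "clopen_sets \<subseteq> Pow G" by (rule clopen_sets_Pow)
    show "compose V g \<in> space M \<rightarrow> G" using compose_G[OF g] sp by auto
    fix A assume "A \<in> clopen_sets"
    then obtain F where "invariant F A" by (auto simp: clopen_sets_def)
    then have "{h \<in> G. compose V g h \<in> A} \<in> clopen_sets"
      using invariant_vimage g by (auto simp: clopen_sets_def)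
    moreover have "compose V g -` A \<inter> space M = {h \<in> G. compose V g h \<in> A}" using sp by auto
    ultimately show "compose V g -` A \<inter> space M \<in> sets M" using clopen_meas by simp
  qed
  have distr_eq: "distr M M (compose V g) = M" if g: "g \<in> G" for g
  proof (rule measure_eqI_generator_eq[OF Int_stable_clopen clopen_sets_Pow])
    show "sets (distr M M (compose V g)) = sigma_sets G clopen_sets" by (simp add: st)
    show "emeasure (distr M M (compose V g)) A = emeasure M A" if A: "A \<in> clopen_sets" for A
    proof -
      obtain F where "invariant F A" using A by (auto simp: clopen_sets_def)
      then have "{h \<in> G. compose V g h \<in> A} \<in> clopen_sets"
        using invariant_vimage g by (auto simp: clopen_sets_def)
      moreover have "compose V g -` A \<inter> space M = {h \<in> G. compose V g h \<in> A}" using sp by auto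
      ultimately show ?thesis
        using emeasure_distr[OF tr_meas[OF g] clopen_meas[OF A]] em A content_vimage[OF A g] by simp
    qed
    show "range (\<lambda>i::nat. G) \<subseteq> clopen_sets" "(\<Union>i::nat. G) = G" using G_clopen by auto
    show "emeasure (distr M M (compose V g)) G \<noteq> \<infinity>" for i :: nat
      using emeasure_distr[OF tr_meas[OF g] clopen_meas[OF G_clopen]] by (simp add: emeasure_eq_measure)
  qed (simp add: st)
  have "emeasure M (compose V g ` A) = emeasure M A" if g: "g \<in> G" and A: "A \<in> sets M" for g A
  proof -
    obtain k where k: "k \<in> G" "\<And>v. v \<in> V \<Longrightarrow> k (g v) = v" "\<And>v. v \<in> V \<Longrightarrow> g (k v) = v"
      using inverse_G[OF g] by metis
    have AG: "A \<subseteq> G" using sets.sets_into_space[OF A] sp by simp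
    have kg: "compose V k (compose V g h) = h" "compose V g (compose V k h) = h" if "h \<in> G" for h
      using k that G_ext[OF that] G_in[OF that] by (auto simp: compose_def extensional_def fun_eq_iff)
    \<comment> \<open>Invariance is demanded for images, but push-forwards speak of preimages: the
      image under \<open>g\<close> is the preimage under its inverse \<open>k\<close>.\<close>
    have "compose V k -` A \<inter> space M = compose V g ` A"
    proof (intro equalityI subsetI)
      fix h assume "h \<in> compose V k -` A \<inter> space M"
      then show "h \<in> compose V g ` A" using kg(2)[of h] sp by (metis Int_iff image_eqI vimage_eq)
    next
      fix h assume "h \<in> compose V g ` A"
      then show "h \<in> compose V k -` A \<inter> space M" using kg(1) AG compose_G[OF g] sp by auto
    qed
    then show ?thesis using emeasure_distr[OF tr_meas[OF k(1)] A] distr_eq[OF k(1)] by simp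
  qed
  then have "is_haar_prob H T M"
    unfolding is_haar_prob_iff using prob_space_axioms sp st by blast
  then show ?thesis ..
qed

lemma is_haar_prob_haar_prob: "is_haar_prob H T (haar_prob H T)"
  unfolding haar_prob_def by (rule theI') (use haar_prob_exists haar_prob_unique in blast)

end

section \<open>Orbit counting with the Haar measure\<close>

context closed_perm_group begin

lemma haar_measure_stabilizer_pos:
  assumes "is_haar_prob H T M" "finite F" "F \<subseteq> V"
  shows "measure M (cyl F e) > 0"
proof -
  have "e \<in> cyl F e" using one_G by (simp add: cyl_def)
  then have "card (res F (cyl F e)) > 0"
    using finite_res[OF invariant_cyl[OF assms(2,3)]] by (auto simp: res_def card_gt_0_iff)
  then show ?thesis
    using haar_measure_invariant[OF assms(1) invariant_cyl[OF assms(2,3)]] card_res_G_pos[OF assms(2,3)]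
    by (simp add: density_def)
qed

lemma haar_measure_cyl:
  assumes "is_haar_prob H T M" "finite F" "F \<subseteq> V" "g \<in> G"
  shows "measure M (cyl F g) = measure M (cyl F e)"
proof -
  have "cyl F e \<in> sets M"
    using assms(1) invariant_cyl[OF assms(2,3)] unfolding is_haar_prob_iff
    by (auto simp: clopen_sets_def intro: sigma_sets.Basic)
  then show ?thesis
    using assms(1,4) translate_cyl[OF assms(4,3)] unfolding is_haar_prob_iff measure_def by metis
qed

text \<open>The stabilizer of \<open>F\<close> acts on \<open>W\<close> within the fibres of
  \<open>S\<close>, so an orbit is no larger than the fibre containing it. As in Burnside's lemma,
  the mean number of fixed points is the number of orbits, hence at least the number of
  fibres.\<close>

lemma haar_integral_fixed_points_ge:
  assumes M: "is_haar_prob H T M" and F: "finite F" "F \<subseteq> V" and W: "finite W" "W \<subseteq> V"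
    and inv: "\<And>g w. g \<in> cyl F e \<Longrightarrow> w \<in> W \<Longrightarrow> g w \<in> W \<and> S (g w) = S w"
  shows "set_lebesgue_integral M (cyl F e) (\<lambda>g. real (card {w\<in>W. g w = w})) \<ge>
           real (card (S ` W)) * measure M (cyl F e)"
proof -
  interpret prob_space M using M by (simp add: is_haar_prob_def)
  let ?A = "cyl F e" and ?fib = "\<lambda>w. {x\<in>W. S x = S w}"
  have cyl_sets: "cyl F' g \<in> sets M" if "finite F'" "F' \<subseteq> V" for F' g
    using M invariant_cyl[OF that] unfolding is_haar_prob_iff
    by (auto simp: clopen_sets_def intro: sigma_sets.Basic)
  \<comment> \<open>The elements of \<open>cyl F e\<close> sending \<open>w\<close> to a given
    \<open>x\<close> form a coset of the stabilizer of \<open>w\<close>, or there are none. Since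
    \<open>x\<close> ranges over the fibre of \<open>w\<close>, the index is bounded by the size of
    that fibre.\<close>
  have stab: "measure M (cyl (insert w F) e) \<ge> measure M ?A / card (?fib w)" if w: "w \<in> W" for w
  proof -
    have wV: "finite (insert w F)" "insert w F \<subseteq> V" using F W w by auto
    let ?B = "\<lambda>x. {g \<in> ?A. g w = x}"
    have B: "?B x \<in> sets M \<and> measure M (?B x) \<le> measure M (cyl (insert w F) e)" for x
    proof (cases "?B x = {}")
      case True
      show ?thesis unfolding True by simp
    next
      case False
      then obtain k where k: "k \<in> ?A" "k w = x" by blast
      have "?B x = cyl (insert w F) k" using k by (auto simp: cyl_def)
      moreover have "k \<in> G" using k by (simp add: cyl_def)
      ultimately show ?thesis using haar_measure_cyl[OF M wV] cyl_sets[OF wV] by simp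
    qed
    have "?A = (\<Union>x\<in>?fib w. ?B x)" using inv w by auto
    then have "measure M ?A = measure M (\<Union>x\<in>?fib w. ?B x)" by simp
    also have "\<dots> \<le> (\<Sum>x\<in>?fib w. measure M (?B x))"
      using B W by (intro finite_measure_subadditive_finite) auto
    also have "\<dots> \<le> (\<Sum>x\<in>?fib w. measure M (cyl (insert w F) e))"
      using B by (intro sum_mono) blast
    also have "\<dots> = card (?fib w) * measure M (cyl (insert w F) e)" by simp
    finally show ?thesis
      using w W(1) by (subst pos_divide_le_eq) (auto simp: card_gt_0_iff mult.commute)
  qed
  \<comment> \<open>A fibre with N elements contributes N times 1/N.\<close>
  have "real (card (S ` W)) = (\<Sum>s\<in>S ` W. 1)" by simp
  also have "\<dots> = (\<Sum>s\<in>S ` W. \<Sum>w\<in>{w\<in>W. S w = s}. 1 / card (?fib w))"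
  proof (rule sum.cong[OF refl])
    fix s assume "s \<in> S ` W"
    then have "card {w\<in>W. S w = s} \<noteq> 0" using W(1) by auto
    moreover have "(\<Sum>w\<in>{w\<in>W. S w = s}. 1 / real (card (?fib w))) =
        (\<Sum>w\<in>{w\<in>W. S w = s}. 1 / real (card {w\<in>W. S w = s}))"
      by (intro sum.cong refl) auto
    ultimately show "1 = (\<Sum>w\<in>{w\<in>W. S w = s}. 1 / real (card (?fib w)))" by simp
  qed
  also have "\<dots> = (\<Sum>w\<in>W. 1 / card (?fib w))" by (rule sum.image_gen[OF W(1), symmetric])
  finally have "real (card (S ` W)) * measure M ?A = (\<Sum>w\<in>W. measure M ?A / card (?fib w))"
    by (simp add: sum_distrib_right)
  also have "\<dots> \<le> (\<Sum>w\<in>W. measure M (cyl (insert w F) e))"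
    using stab by (intro sum_mono) auto
  \<comment> \<open>The number of fixed points in \<open>W\<close> is the sum over \<open>w\<close>
    of the indicators of the stabilizers of \<open>w\<close>; the sum and the integral are
    exchanged.\<close>
  also have "\<dots> = (\<Sum>w\<in>W. \<integral>g. indicat_real (cyl (insert w F) e) g \<partial>M)"
    using W by (intro sum.cong refl) (use F cyl_sets in \<open>auto simp: subset_iff\<close>)
  also have "\<dots> = (\<integral>g. (\<Sum>w\<in>W. indicat_real (cyl (insert w F) e) g) \<partial>M)"
    using W F cyl_sets by (intro Bochner_Integration.integral_sum[symmetric]) (auto simp: emeasure_eq_measure subset_iff)
  also have "\<dots> = set_lebesgue_integral M ?A (\<lambda>g. real (card {w\<in>W. g w = w}))"
    unfolding set_lebesgue_integral_def
  proof (rule Bochner_Integration.integral_cong[OF refl])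
    fix g
    have "(\<Sum>w\<in>W. indicat_real (cyl (insert w F) e) g) = (\<Sum>w\<in>W. indicat_real ?A g * (if g w = w then 1 else 0))"
      using W by (intro sum.cong refl) (auto simp: indicator_def cyl_def)
    also have "\<dots> = indicat_real ?A g * real (card {w\<in>W. g w = w})"
      using W(1) by (simp add: sum_distrib_left[symmetric] sum.If_cases Int_def)
    finally show "(\<Sum>w\<in>W. indicat_real (cyl (insert w F) e) g) =
        indicat_real ?A g *\<^sub>R real (card {w\<in>W. g w = w})" by simp
  qed
  finally show ?thesis .
qed

end

section \<open>Evaluating rational functions at transcendental points\<close>

locale field_embedding =
  fixes h :: "'k::field \<Rightarrow> 'b::field"
  assumes hom_1 [simp]: "h 1 = 1"
    and hom_add [simp]: "h (x + y) = h x + h y"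
    and hom_mult [simp]: "h (x * y) = h x * h y"
begin

lemma hom_0 [simp]: "h 0 = 0"
  using hom_add[of 0 0] by (metis add_0 add_cancel_right_left)

lemma hom_minus [simp]: "h (- x) = - h x"
  using hom_add[of x "- x"] by (simp add: eq_neg_iff_add_eq_0 add.commute)

lemma hom_eq_0_iff [simp]: "h x = 0 \<longleftrightarrow> x = 0"
  using hom_mult[of x "inverse x"] by (cases "x = 0") auto

lemma hom_divide [simp]: "h (x / y) = h x / h y"
proof (cases "y = 0")
  case False
  then have "h (x / y) * h y = h x" by (simp flip: hom_mult)
  then show ?thesis using False by (simp add: nonzero_eq_divide_eq)
qed simp

lemma hom_power [simp]: "h (x ^ n) = h x ^ n"
  by (induction n) auto

lemma hom_of_nat [simp]: "h (of_nat n) = of_nat n"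
  by (induction n) auto

definition ev :: "'k poly \<Rightarrow> 'b \<Rightarrow> 'b" where
  "ev p z = poly (map_poly h p) z"

lemma ev_0 [simp]: "ev 0 z = 0"
  by (simp add: ev_def)

lemma ev_pCons [simp]: "ev (pCons c p) z = h c + z * ev p z"
  by (simp add: ev_def map_poly_pCons)

lemma ev_1 [simp]: "ev 1 z = 1"
  by (simp add: ev_def)

lemma ev_add [simp]: "ev (p + q) z = ev p z + ev q z"
proof -
  have "map_poly h (p + q) = map_poly h p + map_poly h q"
    by (intro poly_eqI) (simp add: coeff_map_poly)
  then show ?thesis by (simp add: ev_def)
qed

lemma ev_smult [simp]: "ev (Polynomial.smult c p) z = h c * ev p z"
  by (simp add: ev_def map_poly_smult)

lemma ev_mult [simp]: "ev (p * q) z = ev p z * ev q z"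
  by (induction p) (auto simp: algebra_simps mult_pCons_left)

lemma ev_power [simp]: "ev (p ^ n) z = ev p z ^ n"
  by (induction n) auto

lemma ev_sum: "ev (sum f A) z = (\<Sum>x\<in>A. ev (f x) z)"
  by (induction A rule: infinite_finite_induct) auto

lemma ev_monom [simp]: "ev (Polynomial.monom c n) z = h c * z ^ n"
  by (simp add: ev_def map_poly_monom poly_monom)

lemma ev_hom: "ev p (h c) = h (poly p c)"
  by (induction p) auto

text \<open>Over an algebraically closed field, \<open>p\<close> splits into linear factors, and
  none of these vanishes at a point outside the image of the field. So such points are
  transcendental.\<close>

lemma ev_nonzero_if_splits:
  assumes root: "\<And>p :: 'k poly. Polynomial.degree p > 0 \<Longrightarrow> \<exists>x. poly p x = 0"
    and "p \<noteq> 0" "z \<notin> range h"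
  shows "ev p z \<noteq> 0"
  using assms(2)
proof (induction "Polynomial.degree p" arbitrary: p)
  case 0
  then obtain c where "p = [:c:]" using degree_eq_zeroE by metis
  then show ?case using 0 by auto
next
  case (Suc n)
  then obtain x where "poly p x = 0" using root[of p] by auto
  then obtain q where q: "p = [:-x, 1:] * q" by (auto simp: poly_eq_0_iff_dvd)
  have q0: "q \<noteq> 0" using Suc q by auto
  then have "Polynomial.degree p = Suc (Polynomial.degree q)"
    unfolding q by (subst Polynomial.degree_mult_eq) auto
  then have "ev q z \<noteq> 0" using Suc q0 by auto
  moreover have "z - h x \<noteq> 0" using assms(3) by auto
  moreover have "ev p z = (z - h x) * ev q z" unfolding q ev_mult by simp
  ultimately show ?case by simp
qed

end

interpretation rf_const: field_embedding "rf_const :: 'k::field_gcd \<Rightarrow> _"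
  by standard (auto simp: rf_const_def one_pCons simp flip: to_fract_1 to_fract_add to_fract_mult)

lemma rf_den_nonzero [simp]: "rf_den f \<noteq> 0"
  by (simp add: rf_den_def)

lemma coprime_rf_num_den: "coprime (rf_num f) (rf_den f)"
  using quot_of_fract_in_normalized_fracts[of f]
  unfolding normalized_fracts_def rf_num_def rf_den_def by (auto simp: case_prod_beta)

lemma rf_num_over_rf_den: "Fraction_Field.Fract (rf_num f) (rf_den f) = f"
  using quot_to_fract_quot_of_fract[of f]
  unfolding quot_to_fract_def rf_num_def rf_den_def by (simp add: case_prod_beta)

locale transcendental_eval = field_embedding h for h :: "'k::{alg_closed_field,field_gcd} \<Rightarrow> 'b::field"
begin

lemma rf_eval_conv_ev: "rf_eval h f z = ev (rf_num f) z / ev (rf_den f) z"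
  by (simp add: rf_eval_def ev_def)

lemma ev_nonzero: "p \<noteq> 0 \<Longrightarrow> z \<notin> range h \<Longrightarrow> ev p z \<noteq> 0"
  by (rule ev_nonzero_if_splits) (use alg_closed_imp_poly_has_root in blast)+

text \<open>No denominator vanishes at a transcendental point, so cross-multiplication shows that
  the value is the same for every representing fraction, not only the one in lowest terms.\<close>

lemma rf_eval_Fract:
  assumes "z \<notin> range h" "b \<noteq> 0"
  shows "rf_eval h (Fraction_Field.Fract a b) z = ev a z / ev b z"
proof -
  define f where "f = Fraction_Field.Fract a b"
  have "Fraction_Field.Fract (rf_num f) (rf_den f) = Fraction_Field.Fract a b"
    by (simp add: rf_num_over_rf_den f_def)
  then have "rf_num f * b = a * rf_den f" using assms(2) by (simp add: eq_fract)
  then have "ev (rf_num f * b) z = ev (a * rf_den f) z" by simp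
  then have "ev (rf_num f) z * ev b z = ev a z * ev (rf_den f) z" by simp
  then show ?thesis
    unfolding rf_eval_conv_ev f_def[symmetric] using ev_nonzero[OF assms(2,1)] ev_nonzero[OF rf_den_nonzero assms(1)]
    by (simp add: frac_eq_eq)
qed

section \<open>Evaluation at a transcendental point as a homomorphism\<close>

context
  fixes z assumes z: "z \<notin> range h"
begin

lemma rf_eval_add: "rf_eval h (f + g) z = rf_eval h f z + rf_eval h g z"
proof (cases f, cases g)
  fix a b c d assume *: "f = Fraction_Field.Fract a b" "b \<noteq> 0" "g = Fraction_Field.Fract c d" "d \<noteq> 0"
  then show ?thesis using z ev_nonzero[OF _ z] by (simp add: rf_eval_Fract field_simps)
qed

lemma rf_eval_mult: "rf_eval h (f * g) z = rf_eval h f z * rf_eval h g z"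
proof (cases f, cases g)
  fix a b c d assume *: "f = Fraction_Field.Fract a b" "b \<noteq> 0" "g = Fraction_Field.Fract c d" "d \<noteq> 0"
  then show ?thesis using z ev_nonzero[OF _ z] by (simp add: rf_eval_Fract)
qed

lemma rf_eval_const: "rf_eval h (rf_const c) z = h c"
  using rf_eval_Fract[OF z, of 1 "[:c:]"] by (simp add: rf_const_def to_fract_def)

lemma rf_eval_var: "rf_eval h rf_var z = z"
  using rf_eval_Fract[OF z, of 1 "[:0, 1:]"] by (simp add: rf_var_def to_fract_def)

lemma rf_eval_divide: "rf_eval h (f / g) z = rf_eval h f z / rf_eval h g z"
proof (cases "g = 0")
  case True
  then show ?thesis using rf_eval_const[of 0] by simp
next
  case False
  then have "rf_eval h (f / g) z * rf_eval h g z = rf_eval h f z"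
    by (simp flip: rf_eval_mult)
  moreover have "rf_eval h g z * rf_eval h (1 / g) z = 1"
    using False rf_eval_const[of 1] by (simp flip: rf_eval_mult)
  then have "rf_eval h g z \<noteq> 0" by auto
  ultimately show ?thesis by (simp add: nonzero_eq_divide_eq)
qed

lemma rf_eval_poly: "rf_eval h (poly (map_poly rf_const p) g) z = ev p (rf_eval h g z)"
proof (induction p)
  case 0
  then show ?case using rf_eval_const[of 0] by simp
next
  case (pCons a p)
  then show ?case by (simp add: map_poly_pCons rf_eval_add rf_eval_mult rf_eval_const)
qed

lemma rf_eval_comp: "rf_eval h (rf_comp f g) z = rf_eval h f (rf_eval h g z)"
  unfolding rf_comp_def rf_eval_def[of rf_const] rf_eval_divide rf_eval_poly rf_eval_conv_ev[of f] ..

lemma rf_eval_iter: "rf_eval h (rf_iter f n) z = (rf_eval h f ^^ n) z"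
  by (induction n) (auto simp: rf_iter_def rf_eval_var rf_eval_comp)

end

text \<open>Poles do no harm: the value 0 taken there by convention is again a constant.\<close>

lemma rf_eval_hom: "rf_eval h f (h c) \<in> range h"
  by (auto simp: rf_eval_conv_ev ev_hom simp flip: hom_divide)

text \<open>At a transcendental \<open>z\<close> the two values agree. At a constant
  \<open>z\<close> both are constants, whatever happens at poles, so neither equals
  \<open>y\<close>.\<close>

lemma rf_eval_iter_eq_iff:
  assumes "y \<notin> range h"
  shows "rf_eval h (rf_iter f n) z = y \<longleftrightarrow> (rf_eval h f ^^ n) z = y"
proof (cases "z \<in> range h")
  case True
  then have "(rf_eval h f ^^ n) z \<in> range h"
    by (induction n) (use rf_eval_hom in auto)
  then show ?thesis using True assms rf_eval_hom by fastforce
qed (simp add: rf_eval_iter)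

text \<open>The points of the fibre are roots of \<open>p - y q\<close>. This polynomial is nonzero,
  as otherwise \<open>y\<close> would be a quotient of constants.\<close>

lemma finite_fibre:
  assumes "y \<notin> range h" "q \<noteq> 0"
  shows "finite {z. ev p z / ev q z = y}"
proof -
  let ?r = "map_poly h p - Polynomial.smult y (map_poly h q)"
  have "?r \<noteq> 0"
  proof
    assume "?r = 0"
    then have "poly.coeff ?r (Polynomial.degree q) = 0" by simp
    then have "h (poly.coeff p (Polynomial.degree q)) = y * h (Polynomial.lead_coeff q)"
      by (simp add: coeff_map_poly)
    then have "y = h (poly.coeff p (Polynomial.degree q) / Polynomial.lead_coeff q)"
      using assms(2) by (simp add: nonzero_eq_divide_eq)
    then show False using assms(1) by blast
  qed
  moreover have "{z. ev p z / ev q z = y} \<subseteq> {z. poly ?r z = 0}"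
  proof
    fix z assume "z \<in> {z. ev p z / ev q z = y}"
    then have z: "ev p z / ev q z = y" by simp
    \<comment> \<open>A quotient with zero denominator is 0, so this excludes the poles from the
      fibre.\<close>
    have "y \<noteq> 0" using assms(1) hom_0 by (metis rangeI)
    then show "z \<in> {z. poly ?r z = 0}" using z by (auto simp: ev_def)
  qed
  ultimately show ?thesis using poly_roots_finite finite_subset by blast
qed

text \<open>The degree of \<open>p - y q\<close> is the larger of the two degrees, because the top
  coefficients cannot cancel for nonconstant \<open>y\<close>. So it has a root.\<close>

lemma fibre_nonempty:
  assumes root: "\<And>p :: 'b poly. Polynomial.degree p > 0 \<Longrightarrow> \<exists>x. poly p x = 0"
    and "y \<notin> range h" "coprime p q" "Polynomial.degree p > 0 \<or> Polynomial.degree q > 0"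
  obtains z where "ev p z / ev q z = y" "ev q z \<noteq> 0"
proof -
  let ?r = "map_poly h p - Polynomial.smult y (map_poly h q)"
  let ?d = "max (Polynomial.degree p) (Polynomial.degree q)"
  have "poly.coeff ?r ?d \<noteq> 0"
  proof
    assume "poly.coeff ?r ?d = 0"
    then have *: "h (poly.coeff p ?d) = y * h (poly.coeff q ?d)"
      by (simp add: coeff_map_poly)
    show False
    proof (cases "poly.coeff q ?d = 0")
      case True
      then have "poly.coeff p ?d = 0" using * by simp
      then show False using True assms(4)
        by (metis leading_coeff_0_iff max_def Polynomial.degree_0 not_less0 linorder_not_le)
    next
      case False
      then have "y = h (poly.coeff p ?d / poly.coeff q ?d)" using * by (simp add: nonzero_eq_divide_eq)
      then show False using assms(2) by blast
    qed
  qed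
  then have "Polynomial.degree ?r \<ge> ?d" by (rule le_degree)
  then have "Polynomial.degree ?r > 0" using assms(4) by auto
  then obtain z where "poly ?r z = 0" using root by blast
  then have z: "ev p z = y * ev q z" by (simp add: ev_def)
  \<comment> \<open>The Bezout identity shows that \<open>p\<close> and \<open>q\<close> have no
    common zero, so the root found is not a pole.\<close>
  obtain a b where "a * p + b * q = 1"
    using assms(3) by (metis bezout_coefficients_fst_snd coprime_imp_gcd_eq_1)
  then have "ev (a * p + b * q) z = 1" by simp
  then have "ev q z \<noteq> 0" using z by auto
  then show ?thesis using z by (intro that[of z]) auto
qed

end

interpretation ac: transcendental_eval "ac_const :: 'k::{alg_closed_field,field_gcd} \<Rightarrow> _"
  by standard (auto simp: ac_const_def)

section \<open>The monodromy group as a closed permutation group\<close>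

lemma rf_var_transcendental: "to_ac rf_var \<notin> range ac_const"
  by (auto simp: ac_const_def rf_var_def rf_const_def)

section \<open>Splitting fields of the iterates and their Galois groups\<close>

lemma ring_of_type_algebra_simps [simp]:
  "carrier (ring_of_type_algebra :: 'a::field ring) = UNIV"
  "\<one>\<^bsub>(ring_of_type_algebra :: 'a ring)\<^esub> = 1"
  "\<zero>\<^bsub>(ring_of_type_algebra :: 'a ring)\<^esub> = 0"
  "x \<oplus>\<^bsub>(ring_of_type_algebra :: 'a ring)\<^esub> y = x + y"
  "x \<otimes>\<^bsub>(ring_of_type_algebra :: 'a ring)\<^esub> y = x * y"
  by (simp_all add: ring_of_type_algebra_def)

lemma ring_of_type_algebra_a_inv [simp]: "\<ominus>\<^bsub>(ring_of_type_algebra :: 'a::field ring)\<^esub> x = - x"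
proof -
  interpret R: field "ring_of_type_algebra :: 'a ring" by (rule field_from_type_algebra)
  show ?thesis by (rule R.minus_equality) auto
qed

lemma ring_of_type_algebra_m_inv [simp]:
  assumes "x \<noteq> 0"
  shows "inv\<^bsub>(ring_of_type_algebra :: 'a::field ring)\<^esub> x = inverse x"
proof -
  interpret R: field "ring_of_type_algebra :: 'a ring" by (rule field_from_type_algebra)
  show ?thesis by (rule R.comm_inv_char) (use assms in auto)
qed

context
  fixes f :: "'k::{alg_closed_field,field_gcd} poly fract" and n :: nat
begin

lemma splitting_field_base: "to_ac x \<in> splitting_field f n"
  unfolding splitting_field_def by (rule generate_field.incl) auto

lemma splitting_field_level: "x \<in> rf_level f n \<Longrightarrow> x \<in> splitting_field f n"
  unfolding splitting_field_def by (rule generate_field.incl) auto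

lemma splitting_field_add: "x \<in> splitting_field f n \<Longrightarrow> y \<in> splitting_field f n \<Longrightarrow> x + y \<in> splitting_field f n"
  using generate_field.eng_add[of x ring_of_type_algebra _ y] unfolding splitting_field_def by simp

lemma splitting_field_mult: "x \<in> splitting_field f n \<Longrightarrow> y \<in> splitting_field f n \<Longrightarrow> x * y \<in> splitting_field f n"
  using generate_field.eng_mult[of x ring_of_type_algebra _ y] unfolding splitting_field_def by simp

lemma splitting_field_minus: "x \<in> splitting_field f n \<Longrightarrow> - x \<in> splitting_field f n"
  using generate_field.a_inv[of x ring_of_type_algebra] unfolding splitting_field_def by simp

lemma splitting_field_diff: "x \<in> splitting_field f n \<Longrightarrow> y \<in> splitting_field f n \<Longrightarrow> x - y \<in> splitting_field f n"
  using splitting_field_add[of x "- y"] splitting_field_minus by simp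

lemma splitting_field_0: "0 \<in> splitting_field f n"
  using splitting_field_base[of 0] by simp

lemma splitting_field_inverse: "x \<in> splitting_field f n \<Longrightarrow> inverse x \<in> splitting_field f n"
  using generate_field.m_inv[of x ring_of_type_algebra] splitting_field_0
  unfolding splitting_field_def by (cases "x = 0") auto

lemma splitting_field_divide: "x \<in> splitting_field f n \<Longrightarrow> y \<in> splitting_field f n \<Longrightarrow> x / y \<in> splitting_field f n"
  using splitting_field_mult[of x "inverse y"] splitting_field_inverse by (simp add: divide_inverse)

lemma splitting_field_const: "ac_const c \<in> splitting_field f n"
  using splitting_field_base by (simp add: ac_const_def)

lemma splitting_field_ev: "z \<in> splitting_field f n \<Longrightarrow> ac.ev p z \<in> splitting_field f n"
  by (induction p) (auto intro: splitting_field_0 splitting_field_add splitting_field_mult splitting_field_const)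

lemma splitting_field_rf_eval: "z \<in> splitting_field f n \<Longrightarrow> rf_eval ac_const g z \<in> splitting_field f n"
  unfolding ac.rf_eval_conv_ev by (intro splitting_field_divide splitting_field_ev)

text \<open>The cases carry membership in the field, since the homomorphism laws of Galois elements
  hold only there.\<close>

lemma splitting_field_induct [consumes 1, case_names base level add mult minus inverse]:
  assumes "x \<in> splitting_field f n"
    and "\<And>c. P (to_ac c)" "\<And>v. v \<in> rf_level f n \<Longrightarrow> P v"
    and "\<And>x y. x \<in> splitting_field f n \<Longrightarrow> y \<in> splitting_field f n \<Longrightarrow> P x \<Longrightarrow> P y \<Longrightarrow> P (x + y)"
    and "\<And>x y. x \<in> splitting_field f n \<Longrightarrow> y \<in> splitting_field f n \<Longrightarrow> P x \<Longrightarrow> P y \<Longrightarrow> P (x * y)"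
    and "\<And>x. x \<in> splitting_field f n \<Longrightarrow> P x \<Longrightarrow> P (- x)"
    and "\<And>x. x \<in> splitting_field f n \<Longrightarrow> P x \<Longrightarrow> P (inverse x)"
  shows "P x"
  using assms(1) unfolding splitting_field_def
proof (induction rule: generate_field.induct)
  case one
  then show ?case using assms(2)[of 1] by simp
next
  case (incl h)
  then show ?case using assms(2,3) by auto
next
  case (a_inv h)
  then show ?case using assms(6)[of h] by (simp add: splitting_field_def)
next
  case (m_inv h)
  then show ?case using assms(7)[of h] by (simp add: splitting_field_def)
next
  case (eng_add h1 h2)
  then show ?case using assms(4)[of h1 h2] by (simp add: splitting_field_def)
next
  case (eng_mult h1 h2)
  then show ?case using assms(5)[of h1 h2] by (simp add: splitting_field_def)
qed

context
  fixes \<sigma> assumes \<sigma>: "\<sigma> \<in> level_galois_group f n"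
begin

lemma galois_Bij: "\<sigma> \<in> Bij (splitting_field f n)"
  and galois_base: "\<sigma> (to_ac c) = to_ac c"
  and galois_add: "x \<in> splitting_field f n \<Longrightarrow> y \<in> splitting_field f n \<Longrightarrow> \<sigma> (x + y) = \<sigma> x + \<sigma> y"
  and galois_mult: "x \<in> splitting_field f n \<Longrightarrow> y \<in> splitting_field f n \<Longrightarrow> \<sigma> (x * y) = \<sigma> x * \<sigma> y"
  using \<sigma> unfolding level_galois_group_def galois_group_def by blast+

lemma galois_in: "x \<in> splitting_field f n \<Longrightarrow> \<sigma> x \<in> splitting_field f n"
  using Bij_imp_funcset[OF galois_Bij] by blast

lemma galois_const: "\<sigma> (ac_const c) = ac_const c"
  by (simp add: ac_const_def galois_base)

lemma galois_minus: "x \<in> splitting_field f n \<Longrightarrow> \<sigma> (- x) = - \<sigma> x"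
  using galois_add[of x "- x"] galois_base[of 0] splitting_field_minus[of x]
  by (simp add: eq_neg_iff_add_eq_0 add.commute)

lemma galois_inverse: "x \<in> splitting_field f n \<Longrightarrow> \<sigma> (inverse x) = inverse (\<sigma> x)"
  using galois_mult[of x "inverse x"] galois_base[of 0] galois_base[of 1] splitting_field_inverse[of x]
  by (cases "x = 0") (auto simp: inverse_unique)

lemma galois_divide:
  "x \<in> splitting_field f n \<Longrightarrow> y \<in> splitting_field f n \<Longrightarrow> \<sigma> (x / y) = \<sigma> x / \<sigma> y"
  using galois_mult[of x "inverse y"] galois_inverse[of y] splitting_field_inverse[of y]
  by (simp add: divide_inverse)

lemma galois_ev: "z \<in> splitting_field f n \<Longrightarrow> \<sigma> (ac.ev p z) = ac.ev p (\<sigma> z)"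
proof (induction p)
  case 0
  then show ?case using galois_base[of 0] by simp
next
  case (pCons a p)
  then show ?case
    by (simp add: galois_add galois_mult galois_const splitting_field_const splitting_field_mult splitting_field_ev)
qed

end

text \<open>The vertices of the level generate the splitting field over the base field.\<close>

lemma galois_eqI:
  assumes "\<sigma> \<in> level_galois_group f n" "\<tau> \<in> level_galois_group f n"
    and "\<And>v. v \<in> rf_level f n \<Longrightarrow> \<sigma> v = \<tau> v"
  shows "\<sigma> = \<tau>"
proof (rule extensionalityI)
  show "\<sigma> \<in> extensional (splitting_field f n)" "\<tau> \<in> extensional (splitting_field f n)"
    using galois_Bij[OF assms(1)] galois_Bij[OF assms(2)] Bij_imp_extensional by auto
  fix x assume "x \<in> splitting_field f n"
  then show "\<sigma> x = \<tau> x"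
    by (induction rule: splitting_field_induct)
      (use assms in \<open>auto simp: galois_base galois_add galois_mult galois_minus galois_inverse\<close>)
qed

lemma galois_id: "(\<lambda>x\<in>splitting_field f n. x) \<in> level_galois_group f n"
  using id_Bij splitting_field_base splitting_field_add splitting_field_mult
  by (auto simp: level_galois_group_def galois_group_def)

lemma galois_compose:
  assumes "\<sigma> \<in> level_galois_group f n" "\<tau> \<in> level_galois_group f n"
  shows "compose (splitting_field f n) \<sigma> \<tau> \<in> level_galois_group f n"
  using compose_Bij[OF galois_Bij[OF assms(1)] galois_Bij[OF assms(2)]]
  unfolding level_galois_group_def galois_group_def
  by (auto simp: compose_def splitting_field_base splitting_field_add splitting_field_mult
      galois_base[OF assms(1)] galois_base[OF assms(2)] galois_add[OF assms(2)] galois_mult[OF assms(2)]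
      galois_add[OF assms(1)] galois_mult[OF assms(1)] galois_in[OF assms(2)])

lemma galois_inv_into:
  assumes \<sigma>: "\<sigma> \<in> level_galois_group f n" and x: "x \<in> splitting_field f n"
  shows "inv_into (splitting_field f n) \<sigma> x \<in> splitting_field f n"
    and "\<sigma> (inv_into (splitting_field f n) \<sigma> x) = x"
    and "inv_into (splitting_field f n) \<sigma> (\<sigma> x) = x"
proof -
  have "inj_on \<sigma> (splitting_field f n)" "\<sigma> ` splitting_field f n = splitting_field f n"
    using galois_Bij[OF \<sigma>] by (auto simp: Bij_def bij_betw_def)
  then show "inv_into (splitting_field f n) \<sigma> x \<in> splitting_field f n"
      "\<sigma> (inv_into (splitting_field f n) \<sigma> x) = x" "inv_into (splitting_field f n) \<sigma> (\<sigma> x) = x"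
    using x by (simp_all add: inv_into_into f_inv_into_f)
qed

lemma galois_inv:
  assumes \<sigma>: "\<sigma> \<in> level_galois_group f n"
  shows "(\<lambda>x\<in>splitting_field f n. inv_into (splitting_field f n) \<sigma> x) \<in> level_galois_group f n"
proof -
  let ?K = "splitting_field f n"
  let ?i = "inv_into ?K \<sigma>"
  note i = galois_inv_into[OF \<sigma>]
  have add: "?i (x + y) = ?i x + ?i y" if "x \<in> ?K" "y \<in> ?K" for x y
    using i(3)[OF splitting_field_add[OF i(1)[OF that(1)] i(1)[OF that(2)]]] that
    by (simp add: galois_add[OF \<sigma>] i)
  have mult: "?i (x * y) = ?i x * ?i y" if "x \<in> ?K" "y \<in> ?K" for x y
    using i(3)[OF splitting_field_mult[OF i(1)[OF that(1)] i(1)[OF that(2)]]] that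
    by (simp add: galois_mult[OF \<sigma>] i)
  have base: "?i (to_ac c) = to_ac c" for c
    using i(3)[OF splitting_field_base] by (simp add: galois_base[OF \<sigma>])
  show ?thesis
    using restrict_inv_into_Bij[OF galois_Bij[OF \<sigma>]] add mult base
    unfolding level_galois_group_def galois_group_def
    by (auto simp: splitting_field_base splitting_field_add splitting_field_mult)
qed

end

section \<open>The levels of the tree and the tower of splitting fields\<close>

locale nonconstant_rf =
  fixes f :: "'k::{alg_closed_field,field_gcd} poly fract"
  assumes nonconst: "rf_degree f > 0"
begin

abbreviation F where "F \<equiv> rf_eval ac_const f"
abbreviation L where "L \<equiv> rf_level f"
abbreviation K where "K \<equiv> splitting_field f"
abbreviation V where "V \<equiv> tree_vertices f"

text \<open>Since t is transcendental, formal iterates may be replaced by iterates of the map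
  \<open>F\<close>, which makes recursion over the levels available.\<close>

lemma level_iff: "z \<in> L n \<longleftrightarrow> (F ^^ n) z = to_ac rf_var"
  unfolding rf_level_def using ac.rf_eval_iter_eq_iff[OF rf_var_transcendental] by simp

lemma level_0: "L 0 = {to_ac rf_var}"
  by (auto simp: level_iff)

lemma level_Suc_iff: "z \<in> L (Suc n) \<longleftrightarrow> F z \<in> L n"
  unfolding level_iff by (simp only: funpow_Suc_right o_apply)

text \<open>\<open>F\<close> maps constants to constants, so a constant vertex would force t to be
  constant.\<close>

lemma level_transcendental: "z \<in> L n \<Longrightarrow> z \<notin> range ac_const"
proof (induction n arbitrary: z)
  case 0
  then show ?case using rf_var_transcendental by (simp add: level_0)
next
  case (Suc n)
  then have "F z \<notin> range ac_const" by (simp add: level_Suc_iff)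
  then show ?case using ac.rf_eval_hom by blast
qed

lemma finite_level: "finite (L n)"
proof (induction n)
  case 0
  then show ?case by (simp add: level_0)
next
  case (Suc n)
  have "L (Suc n) = (\<Union>y\<in>L n. {z. F z = y})" by (auto simp: level_Suc_iff)
  moreover have "finite {z. F z = y}" if "y \<in> L n" for y
    unfolding ac.rf_eval_conv_ev by (rule ac.finite_fibre[OF level_transcendental[OF that]]) simp
  ultimately show ?case using Suc by simp
qed

lemma level_surj:
  assumes "y \<in> L n"
  obtains z where "z \<in> L (Suc n)" "F z = y"
proof -
  obtain z where "ac.ev (rf_num f) z / ac.ev (rf_den f) z = y"
  proof (rule ac.fibre_nonempty[OF _ level_transcendental[OF assms] coprime_rf_num_den[of f]])
    show "\<exists>x. poly p x = 0" if "0 < Polynomial.degree p" for p :: "'k poly fract alg_closure poly"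
      using alg_closed_imp_poly_has_root[OF that] by blast
    show "0 < Polynomial.degree (rf_num f) \<or> 0 < Polynomial.degree (rf_den f)"
      using nonconst by (auto simp: rf_degree_def)
  qed
  then show ?thesis using assms by (intro that[of z]) (auto simp: level_Suc_iff ac.rf_eval_conv_ev)
qed

text \<open>A vertex of level \<open>n\<close> is the image under \<open>F\<close> of a vertex one
  level further down, hence a rational expression in it.\<close>

lemma splitting_field_Suc: "K n \<subseteq> K (Suc n)"
proof
  fix x assume "x \<in> K n"
  then show "x \<in> K (Suc n)"
  proof (induction rule: splitting_field_induct)
    case (level v)
    then obtain z where "z \<in> L (Suc n)" "F z = v" using level_surj by blast
    then show ?case using splitting_field_rf_eval[OF splitting_field_level] by metis
  qed (auto intro: splitting_field_base splitting_field_add splitting_field_mult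
      splitting_field_minus splitting_field_inverse)
qed

lemma level_vertices: "v \<in> L n \<Longrightarrow> v \<in> V"
  by (auto simp: tree_vertices_def)

lemma limit_galois: "\<sigma> \<in> galois_limit f \<Longrightarrow> \<sigma> n \<in> level_galois_group f n"
  by (simp add: galois_limit_def)

lemma limit_Suc: "\<sigma> \<in> galois_limit f \<Longrightarrow> x \<in> K n \<Longrightarrow> \<sigma> (Suc n) x = \<sigma> n x"
  unfolding galois_limit_def by (metis (mono_tags, lifting) mem_Collect_eq restrict_apply')

lemma limitI:
  assumes "\<And>n. \<sigma> n \<in> level_galois_group f n" "\<And>n x. x \<in> K n \<Longrightarrow> \<sigma> (Suc n) x = \<sigma> n x"
  shows "\<sigma> \<in> galois_limit f"
proof -
  have "restrict (\<sigma> (Suc n)) (K n) = \<sigma> n" for n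
    using assms(2) Bij_imp_extensional[OF galois_Bij[OF assms(1)[of n]]]
    by (auto simp: restrict_def extensional_def fun_eq_iff)
  then show ?thesis using assms(1) by (simp add: galois_limit_def)
qed

lemma tree_autD:
  assumes "g \<in> tree_aut f"
  shows "g \<in> Bij V" "g ` L n = L n" "v \<in> L (Suc n) \<Longrightarrow> g (F v) = F (g v)"
  using assms unfolding tree_aut_def by blast+

lemma tree_aut_in: "g \<in> tree_aut f \<Longrightarrow> v \<in> L n \<Longrightarrow> g v \<in> L n"
  using tree_autD(2) by blast

lemma tree_autI:
  assumes "g \<in> Bij V" "\<And>n. g ` L n = L n" "\<And>n v. v \<in> L (Suc n) \<Longrightarrow> g (F v) = F (g v)"
  shows "g \<in> tree_aut f"
  using assms by (auto simp: tree_aut_def)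

lemma img_carrierD:
  assumes "g \<in> img_carrier f"
  shows "g \<in> tree_aut f" "\<exists>\<sigma>\<in>galois_limit f. \<forall>n. \<forall>v\<in>L n. g v = \<sigma> n v"
  using assms unfolding img_carrier_def by blast+

lemma img_carrierI:
  assumes "g \<in> tree_aut f" "\<sigma> \<in> galois_limit f" "\<And>n v. v \<in> L n \<Longrightarrow> g v = \<sigma> n v"
  shows "g \<in> img_carrier f"
  using assms unfolding img_carrier_def by blast

section \<open>The monodromy group as a closed subgroup\<close>

lemma id_img_carrier: "(\<lambda>v\<in>V. v) \<in> img_carrier f"
proof (rule img_carrierI)
  show "(\<lambda>v\<in>V. v) \<in> tree_aut f"
  proof (rule tree_autI)
    show "(\<lambda>v\<in>V. v) ` L n = L n" for n
      using level_vertices by (auto simp: image_iff)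
    show "(\<lambda>v\<in>V. v) (F v) = F ((\<lambda>v\<in>V. v) v)" if "v \<in> L (Suc n)" for n v
      using level_vertices[OF that] level_vertices[OF that[unfolded level_Suc_iff]] by simp
  qed (rule id_Bij)
  show "(\<lambda>n. \<lambda>x\<in>K n. x) \<in> galois_limit f"
    using galois_id splitting_field_Suc by (intro limitI) auto
  show "(\<lambda>v\<in>V. v) v = (\<lambda>x\<in>K n. x) v" if "v \<in> L n" for n v
    using level_vertices[OF that] splitting_field_level[OF that] by simp
qed

lemma compose_img_carrier:
  assumes "g \<in> img_carrier f" "h \<in> img_carrier f"
  shows "compose V g h \<in> img_carrier f"
proof -
  obtain \<sigma> where g: "g \<in> tree_aut f" "\<sigma> \<in> galois_limit f" "\<And>n v. v \<in> L n \<Longrightarrow> g v = \<sigma> n v"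
    using img_carrierD[OF assms(1)] by blast
  obtain \<tau> where h: "h \<in> tree_aut f" "\<tau> \<in> galois_limit f" "\<And>n v. v \<in> L n \<Longrightarrow> h v = \<tau> n v"
    using img_carrierD[OF assms(2)] by blast
  note vert = level_vertices
  show ?thesis
  proof (rule img_carrierI)
    show "compose V g h \<in> tree_aut f"
    proof (rule tree_autI)
      show "compose V g h \<in> Bij V" using compose_Bij tree_autD(1) g(1) h(1) by blast
      have "compose V g h ` L n = g ` h ` L n" for n
        unfolding image_image using vert by (intro image_cong refl) (simp add: compose_def)
      then show "compose V g h ` L n = L n" for n
        using tree_autD(2)[OF g(1)] tree_autD(2)[OF h(1)] by simp
      show "compose V g h (F v) = F (compose V g h v)" if v: "v \<in> L (Suc n)" for n v
      proof -
        have "F v \<in> V" "v \<in> V" using vert v level_Suc_iff by blast+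
        then show ?thesis
          using tree_autD(3)[OF h(1) v] tree_autD(3)[OF g(1) tree_aut_in[OF h(1) v]] by (simp add: compose_def)
      qed
    qed
    show "(\<lambda>n. compose (K n) (\<sigma> n) (\<tau> n)) \<in> galois_limit f"
    proof (rule limitI)
      show "compose (K n) (\<sigma> n) (\<tau> n) \<in> level_galois_group f n" for n
        by (intro galois_compose limit_galois g h)
      show "compose (K (Suc n)) (\<sigma> (Suc n)) (\<tau> (Suc n)) x = compose (K n) (\<sigma> n) (\<tau> n) x" if x: "x \<in> K n" for n x
        using x splitting_field_Suc[of n] limit_Suc[OF h(2) x]
          limit_Suc[OF g(2) galois_in[OF limit_galois[OF h(2)] x]] by (auto simp: compose_def)
    qed
    show "compose V g h v = compose (K n) (\<sigma> n) (\<tau> n) v" if "v \<in> L n" for n v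
      using that vert[OF that] splitting_field_level[OF that] g(3) h(3) tree_aut_in[OF h(1) that]
      by (simp add: compose_def)
  qed
qed

lemma inv_img_carrier:
  assumes "g \<in> img_carrier f"
  shows "(\<lambda>v\<in>V. inv_into V g v) \<in> img_carrier f"
proof -
  obtain \<sigma> where g: "g \<in> tree_aut f" "\<sigma> \<in> galois_limit f" "\<And>n v. v \<in> L n \<Longrightarrow> g v = \<sigma> n v"
    using img_carrierD[OF assms(1)] by blast
  have inj: "inj_on g V" using tree_autD(1)[OF g(1)] by (simp add: Bij_def bij_betw_def)
  let ?h = "\<lambda>v\<in>V. inv_into V g v"
  have h: "\<exists>w. w \<in> L n \<and> g w = v \<and> ?h v = w" if v: "v \<in> L n" for n v
  proof -
    have "v \<in> g ` L n" using v tree_autD(2)[OF g(1)] by simp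
    then obtain w where w: "w \<in> L n" "v = g w" by blast
    then have "?h v = w" using inv_into_f_f[OF inj level_vertices[OF w(1)]] level_vertices[OF v] by simp
    then show ?thesis using w by (intro exI[of _ w]) simp
  qed
  have hg: "?h (g w) = w" if "w \<in> L n" for n w
    using inv_into_f_f[OF inj level_vertices[OF that]] level_vertices[OF tree_aut_in[OF g(1) that]] by simp
  show ?thesis
  proof (rule img_carrierI)
    show "?h \<in> tree_aut f"
    proof (rule tree_autI)
      show "?h \<in> Bij V" using restrict_inv_into_Bij tree_autD(1) g(1) by blast
      show "?h ` L n = L n" for n
      proof (intro equalityI subsetI)
        fix w assume "w \<in> L n"
        then show "w \<in> ?h ` L n" using hg tree_aut_in[OF g(1)] by (metis imageI)
      qed (use h in fastforce)
      show "?h (F v) = F (?h v)" if v: "v \<in> L (Suc n)" for n v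
      proof -
        obtain w where w: "w \<in> L (Suc n)" "g w = v" "?h v = w" using h[OF v] by blast
        have "?h (g (F w)) = F w" using hg w(1) level_Suc_iff by blast
        then show ?thesis using tree_autD(3)[OF g(1) w(1)] w by simp
      qed
    qed
    show "(\<lambda>n. \<lambda>x\<in>K n. inv_into (K n) (\<sigma> n) x) \<in> galois_limit f"
    proof (rule limitI)
      show "(\<lambda>x\<in>K n. inv_into (K n) (\<sigma> n) x) \<in> level_galois_group f n" for n
        by (intro galois_inv limit_galois g)
      fix n x assume x: "x \<in> K n"
      let ?y = "inv_into (K n) (\<sigma> n) x"
      have y: "?y \<in> K n" "\<sigma> n ?y = x" using galois_inv_into[OF limit_galois[OF g(2)] x] by auto
      have "?y \<in> K (Suc n)" using y splitting_field_Suc by blast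
      then have "inv_into (K (Suc n)) (\<sigma> (Suc n)) (\<sigma> (Suc n) ?y) = ?y"
        by (rule galois_inv_into(3)[OF limit_galois[OF g(2)]])
      then show "(\<lambda>x\<in>K (Suc n). inv_into (K (Suc n)) (\<sigma> (Suc n)) x) x = (\<lambda>x\<in>K n. inv_into (K n) (\<sigma> n) x) x"
        using limit_Suc[OF g(2) y(1)] y(2) x splitting_field_Suc[of n] by auto
    qed
    show "?h v = (\<lambda>x\<in>K n. inv_into (K n) (\<sigma> n) x) v" if v: "v \<in> L n" for n v
    proof -
      obtain w where w: "w \<in> L n" "g w = v" "?h v = w" using h[OF v] by blast
      then have "inv_into (K n) (\<sigma> n) v = w"
        using galois_inv_into(3)[OF limit_galois[OF g(2)] splitting_field_level[OF w(1)]] g(3)[OF w(1)] by simp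
      then show ?thesis using w splitting_field_level[OF v] by simp
    qed
  qed
qed

lemma subgroup_img_carrier: "subgroup (img_carrier f) (BijGroup V)"
proof (rule subgroup.intro)
  have B: "img_carrier f \<subseteq> Bij V" using tree_autD(1) by (auto simp: img_carrier_def)
  then show "img_carrier f \<subseteq> carrier (BijGroup V)" by (simp add: BijGroup_def)
  show "x \<otimes>\<^bsub>BijGroup V\<^esub> y \<in> img_carrier f" if "x \<in> img_carrier f" "y \<in> img_carrier f" for x y
    using that B compose_img_carrier by (auto simp: mult_BijGroup subset_iff)
  show "\<one>\<^bsub>BijGroup V\<^esub> \<in> img_carrier f" using id_img_carrier by (simp add: one_BijGroup)
  show "inv\<^bsub>BijGroup V\<^esub> x \<in> img_carrier f" if "x \<in> img_carrier f" for x
    using inv_img_carrier[OF that] inv_BijGroup[OF subsetD[OF B that]] by simp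
qed

text \<open>For each \<open>n\<close>, approximate \<open>\<phi>\<close> up to level
  \<open>n\<close> by a group element \<open>g n\<close> with Galois lift \<open>s n\<close>. The
  diagonal \<open>s n n\<close> is then a lift of \<open>\<phi>\<close>.\<close>

lemma img_carrier_closed:
  assumes ext: "\<phi> \<in> extensional V"
    and approx: "\<And>W. finite W \<Longrightarrow> W \<subseteq> V \<Longrightarrow> \<exists>g\<in>img_carrier f. \<forall>v\<in>W. g v = \<phi> v"
  shows "\<phi> \<in> img_carrier f"
proof -
  have "\<exists>g \<sigma>. g \<in> tree_aut f \<and> \<sigma> \<in> galois_limit f \<and> (\<forall>m. \<forall>v\<in>L m. g v = \<sigma> m v) \<and> (\<forall>i\<le>n. \<forall>v\<in>L i. g v = \<phi> v)" for n
  proof -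
    have "finite (\<Union>i\<le>n. L i)" "(\<Union>i\<le>n. L i) \<subseteq> V" using finite_level level_vertices by auto
    then obtain g where g: "g \<in> img_carrier f" "\<forall>v\<in>(\<Union>i\<le>n. L i). g v = \<phi> v" using approx by blast
    have "\<forall>i\<le>n. \<forall>v\<in>L i. g v = \<phi> v" using g(2) by blast
    then show ?thesis using img_carrierD[OF g(1)] by blast
  qed
  then obtain g s where gs: "\<And>n. g n \<in> tree_aut f" "\<And>n. s n \<in> galois_limit f"
    "\<And>n m v. v \<in> L m \<Longrightarrow> g n v = s n m v" "\<And>n i v. i \<le> n \<Longrightarrow> v \<in> L i \<Longrightarrow> g n v = \<phi> v" by metis
  have im: "\<phi> ` L n = L n" for n
    using tree_autD(2)[OF gs(1), of n n] gs(4)[of n n] by force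
  show ?thesis
  proof (rule img_carrierI)
    show "\<phi> \<in> tree_aut f"
    proof (rule tree_autI)
      have "inj_on \<phi> V"
      proof (rule inj_onI)
        fix v w assume "v \<in> V" "w \<in> V" and eq: "\<phi> v = \<phi> w"
        then obtain i j where ij: "v \<in> L i" "w \<in> L j" by (auto simp: tree_vertices_def)
        let ?g = "g (max i j)"
        have "?g v = ?g w" using gs(4)[OF _ ij(1)] gs(4)[OF _ ij(2)] eq by simp
        moreover have "inj_on ?g V" using tree_autD(1)[OF gs(1)] by (simp add: Bij_def bij_betw_def)
        ultimately show "v = w" using \<open>v \<in> V\<close> \<open>w \<in> V\<close> by (simp add: inj_on_def)
      qed
      moreover have "\<phi> ` V = V" unfolding tree_vertices_def image_UN im ..
      ultimately show "\<phi> \<in> Bij V" using ext by (simp add: Bij_def bij_betw_def)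
      show "\<phi> (F v) = F (\<phi> v)" if v: "v \<in> L (Suc n)" for n v
        using tree_autD(3)[OF gs(1) v, of "Suc n"] gs(4)[OF _ v, of "Suc n"]
          gs(4)[of n "Suc n" "F v"] v by (simp add: level_Suc_iff)
    qed (rule im)
    \<comment> \<open>Different lifts need not agree globally, but \<open>s (Suc n) n\<close> and
      \<open>s n n\<close> both restrict to \<open>\<phi>\<close> on level \<open>n\<close>, which
      determines them.\<close>
    show "(\<lambda>n. s n n) \<in> galois_limit f"
    proof (rule limitI)
      show "s n n \<in> level_galois_group f n" for n by (rule limit_galois[OF gs(2)])
      fix n x assume x: "x \<in> K n"
      have "s (Suc n) n = s n n"
        using gs(3)[of _ n n] gs(3)[of _ n "Suc n"] gs(4)[of n n] gs(4)[of n "Suc n"]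
        by (intro galois_eqI[OF limit_galois[OF gs(2)] limit_galois[OF gs(2)]]) simp
      then show "s (Suc n) (Suc n) x = s n n x" using limit_Suc[OF gs(2) x] by simp
    qed
    show "\<phi> v = s n n v" if "v \<in> L n" for n v using gs(3)[of v n n] gs(4)[of n n v] that by simp
  qed
qed

sublocale closed_perm_group V "img_carrier f"
proof (rule closed_perm_group.intro)
  show "countable V" using finite_level by (auto simp: tree_vertices_def intro: countable_finite)
  show "finite ((\<lambda>g. g v) ` img_carrier f)" if v: "v \<in> V" for v
  proof -
    obtain n where "v \<in> L n" using v by (auto simp: tree_vertices_def)
    then have "(\<lambda>g. g v) ` img_carrier f \<subseteq> L n" using tree_aut_in by (auto simp: img_carrier_def)
    then show ?thesis using finite_level finite_subset by blast
  qed
qed (use subgroup_img_carrier img_carrier_closed in auto)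

end

section \<open>Failure of the martingale property\<close>

context nonconstant_rf
begin

abbreviation haar where "haar \<equiv> haar_prob (img f) (img_topology f)"

lemma haar: "is_haar_prob H T haar"
  using is_haar_prob_haar_prob by (simp add: img_def img_topology_def)

text \<open>The lift of \<open>g\<close> is the identity on level \<open>n\<close>, hence on the
  field it generates, and compatibility carries this to the next stage.\<close>

lemma stabilizer_fixes_splitting_field:
  assumes "g \<in> cyl (L n) e"
  obtains \<sigma> where "\<sigma> \<in> level_galois_group f (Suc n)" "\<And>v. v \<in> L (Suc n) \<Longrightarrow> g v = \<sigma> v"
    "\<And>x. x \<in> K n \<Longrightarrow> \<sigma> x = x"
proof -
  have "g \<in> img_carrier f" using assms by (simp add: cyl_def)
  then obtain \<sigma> where \<sigma>: "\<sigma> \<in> galois_limit f" "\<forall>n. \<forall>v\<in>L n. g v = \<sigma> n v"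
    using img_carrierD(2) by blast
  have "\<sigma> n = (\<lambda>x\<in>K n. x)"
  proof (rule galois_eqI[OF limit_galois[OF \<sigma>(1)] galois_id])
    fix v assume v: "v \<in> L n"
    then have "g v = v" using assms level_vertices[OF v] by (simp add: cyl_def)
    then show "\<sigma> n v = (\<lambda>x\<in>K n. x) v" using \<sigma>(2) v splitting_field_level[OF v] by simp
  qed
  then have "\<sigma> (Suc n) x = x" if "x \<in> K n" for x
    using limit_Suc[OF \<sigma>(1) that] that by simp
  then show ?thesis using that[of "\<sigma> (Suc n)"] limit_galois[OF \<sigma>(1)] \<sigma>(2) by blast
qed

lemma not_martingale:
  fixes p q :: "'k poly"
  defines "S \<equiv> \<lambda>z. ac.ev p z / ac.ev q z"
  assumes S: "\<And>z. z \<in> L 2 \<Longrightarrow> S z \<in> K 1" and card: "card (L 1) < card (S ` L 2)"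
  shows "\<not> is_martingale haar (fixed_point_process f)"
proof
  assume mart: "is_martingale haar (fixed_point_process f)"
  let ?A = "{\<omega> \<in> space haar. \<forall>i\<in>{1..<2}. fixed_point_process f i \<omega> = real (card (L 1))}"
  have sp: "space haar = img_carrier f" using haar by (simp add: is_haar_prob_iff)
  have L: "finite (L n)" "L n \<subseteq> V" for n using finite_level level_vertices by auto
  \<comment> \<open>The conditioning event, that all of level 1 is fixed, is the pointwise
    stabilizer of level 1.\<close>
  have A: "?A = cyl (L 1) e"
  proof -
    have "fixed_point_process f 1 g = real (card (L 1)) \<longleftrightarrow> (\<forall>v\<in>L 1. g v = e v)" for g
    proof -
      have "fixed_point_process f 1 g = real (card (L 1)) \<longleftrightarrow> card {v \<in> L 1. g v = v} = card (L 1)"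
        by (simp add: fixed_point_process_def)
      also have "\<dots> \<longleftrightarrow> {v \<in> L 1. g v = v} = L 1"
        using card_subset_eq[OF L(1)[of 1], of "{v \<in> L 1. g v = v}"] by auto
      also have "\<dots> \<longleftrightarrow> (\<forall>v\<in>L 1. g v = e v)"
        using level_vertices[of _ 1] by auto
      finally show ?thesis .
    qed
    moreover have "{1..<2} = {1::nat}" by auto
    ultimately show ?thesis by (simp add: sp cyl_def)
  qed
  have pos: "measure haar (cyl (L 1) e) > 0"
    by (rule haar_measure_stabilizer_pos[OF haar L])
  have inv: "g w \<in> L 2 \<and> S (g w) = S w" if g: "g \<in> cyl (L 1) e" and w: "w \<in> L 2" for g w
  proof -
    obtain \<sigma> where \<sigma>: "\<sigma> \<in> level_galois_group f 2" "\<And>v. v \<in> L 2 \<Longrightarrow> g v = \<sigma> v" "\<And>x. x \<in> K 1 \<Longrightarrow> \<sigma> x = x"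
      using stabilizer_fixes_splitting_field[OF g] by (metis Suc_1)
    have wK: "w \<in> K 2" by (rule splitting_field_level[OF w])
    \<comment> \<open>\<open>S\<close> has coefficients in the constants and so commutes with
      \<open>\<sigma>\<close>, which fixes \<open>S w\<close> because that value lies in
      \<open>K 1\<close>.\<close>
    have "S (\<sigma> w) = \<sigma> (S w)"
      unfolding S_def
      by (simp add: galois_divide[OF \<sigma>(1)] galois_ev[OF \<sigma>(1)] wK splitting_field_ev)
    also have "\<dots> = S w" using \<sigma>(3) S[OF w] by simp
    finally have "S (g w) = S w" using \<sigma>(2)[OF w] by simp
    moreover have "g w \<in> L 2"
      using g tree_aut_in[OF _ w] img_carrierD(1) by (auto simp: cyl_def)
    ultimately show ?thesis by simp
  qed
  have "real (card (S ` L 2)) * measure haar (cyl (L 1) e)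
      \<le> set_lebesgue_integral haar (cyl (L 1) e) (fixed_point_process f 2)"
    unfolding fixed_point_process_def by (rule haar_integral_fixed_points_ge[OF haar L L]) (rule inv)
  moreover have "set_lebesgue_integral haar (cyl (L 1) e) (fixed_point_process f 2) / measure haar (cyl (L 1) e)
      = real (card (L 1))"
    using mart[unfolded is_martingale_def Let_def, rule_format, of 2 "\<lambda>_. real (card (L 1))"] pos
    unfolding A by simp
  ultimately have "real (card (S ` L 2)) \<le> real (card (L 1))"
    using pos by (simp add: field_simps)
  then show False using card by simp
qed

end

section \<open>The explicit family of rational functions\<close>

lemma sum_even_odd:
  fixes g :: "nat \<Rightarrow> 'a::comm_monoid_add"
  shows "(\<Sum>k\<le>2 * r. g k) = (\<Sum>j\<le>r. g (2 * j)) + (\<Sum>j<r. g (2 * j + 1))"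
  by (induction r) (simp_all add: add_ac)

text \<open>The odd powers of \<open>x\<close> cancel in the sum of the two binomial
  expansions.\<close>

lemma even_binomial_sum:
  fixes x :: "'a::comm_ring_1"
  shows "2 * (\<Sum>j\<le>r. of_nat (2 * r choose (2 * j)) * (x\<^sup>2) ^ j) = (x + 1) ^ (2 * r) + (x - 1) ^ (2 * r)"
proof -
  let ?g = "\<lambda>k. of_nat (2 * r choose k) * (x ^ k + (- x) ^ k)"
  have "(x + 1) ^ (2 * r) + (x - 1) ^ (2 * r) = (x + 1) ^ (2 * r) + (- x + 1) ^ (2 * r)"
  proof -
    have "(- x + 1) ^ (2 * r) = (- (x - 1)) ^ (2 * r)" by simp
    also have "\<dots> = (x - 1) ^ (2 * r)" by (rule power_minus_even) simp
    finally show ?thesis by simp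
  qed
  also have "\<dots> = (\<Sum>k\<le>2 * r. ?g k)"
    unfolding binomial_ring[of x 1] binomial_ring[of "- x" 1]
    by (simp add: distrib_left sum.distrib)
  also have "\<dots> = (\<Sum>j\<le>r. ?g (2 * j))"
    unfolding sum_even_odd by simp
  also have "\<dots> = 2 * (\<Sum>j\<le>r. of_nat (2 * r choose (2 * j)) * (x\<^sup>2) ^ j)"
  proof -
    have "x ^ (2 * j) + (- x) ^ (2 * j) = 2 * (x\<^sup>2) ^ j" for j
      unfolding power_mult by simp
    then show ?thesis by (simp add: sum_distrib_left mult.left_commute)
  qed
  finally show ?thesis ..
qed

text \<open>Its value at \<open>x^2\<close> is half of \<open>(x + 1)^(2r) + (x - 1)^(2r)\<close>,
  by \<open>even_binomial_sum\<close>.\<close>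

definition half_poly :: "nat \<Rightarrow> complex poly" where
  "half_poly r = (\<Sum>j\<le>r. Polynomial.monom (of_nat (2 * r choose (2 * j))) j)"

text \<open>The function whose square is scaled by \<open>a\<close> is the Chebyshev polynomial of
  degree \<open>r\<close> at \<open>(x + 1) / (x - 1) = (z + 1/z) / 2\<close>. Its symmetries,
  \<open>z\<close> to \<open>1/z\<close> and rotations of \<open>z\<close> by r-th roots of unity,
  form a dihedral group.\<close>

definition dihedral_rf :: "nat \<Rightarrow> complex \<Rightarrow> complex poly fract" where
  "dihedral_rf r a = Fraction_Field.Fract (Polynomial.smult a ((half_poly r)\<^sup>2)) ([:-1, 1:] ^ (2 * r))"

lemma degree_half_poly: "Polynomial.degree (half_poly r) = r"
proof (rule antisym)
  show "Polynomial.degree (half_poly r) \<le> r"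
    unfolding half_poly_def
    by (intro degree_sum_le) (auto intro: order_trans[OF Polynomial.degree_monom_le])
  have "poly.coeff (half_poly r) r = 1"
    by (simp add: half_poly_def Polynomial.coeff_sum)
  then show "r \<le> Polynomial.degree (half_poly r)" by (intro le_degree) simp
qed

text \<open>The value is a positive integer. It makes \<open>half_poly r\<close> coprime to
  \<open>x - 1\<close>.\<close>

lemma poly_half_poly_1: "poly (half_poly r) 1 \<noteq> 0"
proof -
  have "poly (half_poly r) 1 = of_nat (\<Sum>j\<le>r. 2 * r choose (2 * j))"
    by (simp add: half_poly_def poly_sum poly_monom)
  moreover have "(\<Sum>j\<le>r. 2 * r choose (2 * j)) > 0" by (rule sum_pos2[of _ 0]) auto
  ultimately show ?thesis by (metis of_nat_eq_0_iff not_gr_zero)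
qed

lemma half_poly_nonzero [simp]: "half_poly r \<noteq> 0"
  using poly_half_poly_1[of r] by auto

lemma coprime_half_poly: "coprime (half_poly r) ([:-1, 1:] ^ n)"
proof -
  have "coprime (half_poly r) [:-1, 1:]"
  proof (rule coprimeI)
    fix d assume d: "d dvd half_poly r" "d dvd [:-1, 1:]"
    have "half_poly r = [:-1, 1:] * synthetic_div (half_poly r) 1 + [:poly (half_poly r) 1:]"
      using synthetic_div_correct'[of 1 "half_poly r"] by simp
    then have "d dvd [:poly (half_poly r) 1:]"
      using d by (metis dvd_add_right_iff dvd_mult2)
    also have "is_unit [:poly (half_poly r) 1:]"
      using poly_half_poly_1 by (simp add: is_unit_const_poly_iff dvd_field_iff)
    finally show "is_unit d" .
  qed
  then show ?thesis by (rule coprime_power_right_iff[THEN iffD2, OF disjI1])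
qed

context
  fixes r :: nat and a :: complex
  assumes a: "a \<noteq> 0"
begin

text \<open>The defining fraction is already in lowest terms with monic denominator, which is the
  normal form chosen by \<open>quot_of_fract\<close>.\<close>

lemma quot_of_dihedral_rf:
  "quot_of_fract (dihedral_rf r a) = (Polynomial.smult a ((half_poly r)\<^sup>2), [:-1, 1:] ^ (2 * r))"
proof -
  have "coprime (Polynomial.smult a ((half_poly r)\<^sup>2)) ([:-1, 1:] ^ (2 * r))"
  proof -
    have "is_unit [:a:]" using a by (simp add: is_unit_const_poly_iff dvd_field_iff)
    then have "coprime ([:a:] * (half_poly r)\<^sup>2) ([:-1, 1:] ^ (2 * r))"
      using coprime_half_poly[of r "2 * r"] is_unit_left_imp_coprime
      by (metis coprime_mult_left_iff coprime_power_left_iff)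
    then show ?thesis by simp
  qed
  moreover have "Polynomial.lead_coeff ([:-1, 1:] ^ (2 * r) :: complex poly) = 1"
    by (simp add: lead_coeff_power)
  then have "unit_factor ([:-1, 1:] ^ (2 * r) :: complex poly) = 1"
    by (simp add: unit_factor_poly_def one_pCons)
  ultimately have "(Polynomial.smult a ((half_poly r)\<^sup>2), [:-1, 1:] ^ (2 * r)) \<in> normalized_fracts"
    by (simp add: normalized_fracts_def)
  then show ?thesis
    using quot_of_fract_quot_to_fract' unfolding quot_to_fract_def dihedral_rf_def by fastforce
qed

lemma rf_num_dihedral_rf: "rf_num (dihedral_rf r a) = Polynomial.smult a ((half_poly r)\<^sup>2)"
  and rf_den_dihedral_rf: "rf_den (dihedral_rf r a) = [:-1, 1:] ^ (2 * r)"
  by (simp_all add: rf_num_def rf_den_def quot_of_dihedral_rf)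

lemma rf_degree_dihedral_rf: "rf_degree (dihedral_rf r a) = 2 * r"
  using a by (simp add: rf_degree_def rf_num_dihedral_rf rf_den_dihedral_rf
      degree_half_poly Polynomial.degree_power_eq)

end

text \<open>With \<open>A = (x + 1)^r\<close> and \<open>B = (x - 1)^r\<close>, the left side is
  \<open>(A^2 + B^2) / (2 A B)\<close>, and \<open>z^r = A / B\<close>.\<close>

lemma eval_dihedral_sqrt:
  fixes x :: "'a::field"
  assumes "(2::'a) \<noteq> 0" "x + 1 \<noteq> 0" "x - 1 \<noteq> 0"
  defines "z \<equiv> (x + 1) / (x - 1)"
  shows "(\<Sum>j\<le>r. of_nat (2 * r choose (2 * j)) * (x\<^sup>2) ^ j) / (x\<^sup>2 - 1) ^ r = (z ^ r + inverse (z ^ r)) / 2"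
proof -
  define s where "s = (\<Sum>j\<le>r. of_nat (2 * r choose (2 * j)) * (x\<^sup>2) ^ j)"
  define A where "A = (x + 1) ^ r"
  define B where "B = (x - 1) ^ r"
  have AB: "A \<noteq> 0" "B \<noteq> 0" using assms by (simp_all add: A_def B_def)
  have "y ^ (2 * r) = y ^ r * y ^ r" for y :: 'a by (simp add: mult_2 power_add)
  then have "2 * s = A * A + B * B"
    using even_binomial_sum[of r x] unfolding s_def A_def B_def by simp
  then have s: "s = (A * A + B * B) / 2"
    using assms(1) by (simp add: eq_divide_eq mult.commute)
  have "x\<^sup>2 - 1 = (x + 1) * (x - 1)" by (simp add: power2_eq_square algebra_simps)
  then have "(x\<^sup>2 - 1) ^ r = A * B" by (simp add: A_def B_def power_mult_distrib)
  moreover have "z ^ r = A / B" by (simp add: z_def A_def B_def power_divide)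
  moreover have "s / (A * B) = (A / B + inverse (A / B)) / 2"
    using AB assms(1) by (simp add: s divide_simps)
  ultimately show ?thesis unfolding s_def by simp
qed

text \<open>For \<open>r \<ge> 2\<close> the root \<open>cis (pi / r)\<close> has positive imaginary
  part, so it is not 1 or -1.\<close>

lemma root_of_minus_one:
  assumes "r \<ge> 2"
  obtains \<zeta> :: complex where "\<zeta> ^ r = -1" "\<zeta> \<noteq> 0" "\<zeta>\<^sup>2 \<noteq> 1"
proof
  have "Im (cis (pi / r)) > 0"
    using assms by (simp add: sin_gt_zero field_simps)
  then show "(cis (pi / r))\<^sup>2 \<noteq> 1"
    unfolding power2_eq_1_iff by (auto simp: complex_eq_iff)
  have "cis (pi / r) ^ r = cis (real r * (pi / r))" by (rule Complex.DeMoivre)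
  also have "real r * (pi / r) = pi" using assms by simp
  finally show "cis (pi / r) ^ r = -1" by simp
qed simp

text \<open>Think of \<open>z\<close> as \<open>exp s\<close>: then \<open>u (x^2) = cosh s\<close>,
  and passing to \<open>y\<close> shifts \<open>s\<close>. The addition formula for cosh yields
  \<open>sinh s = (z - 1/z) / 2 = 2x / (x^2 - 1)\<close>, hence \<open>x\<close>, from
  \<open>x^2\<close> and \<open>y^2\<close> alone; \<open>\<zeta>^2 \<noteq> 1\<close> makes the
  coefficient of sinh invertible.\<close>

lemma sqrt_from_two_roots:
  fixes x y z z' \<zeta> :: "'a::field"
  assumes two: "(2::'a) \<noteq> 0" and x: "x - 1 \<noteq> 0" "z = (x + 1) / (x - 1)" "z \<noteq> 0"
    and y: "y - 1 \<noteq> 0" "\<zeta> * z = (y + 1) / (y - 1)" and \<zeta>: "\<zeta> \<noteq> 0" "\<zeta>\<^sup>2 \<noteq> 1"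
  defines "u \<equiv> \<lambda>v. (v + 1) / (v - 1)"
  shows "x = (x\<^sup>2 - 1) / 2 * ((u (y\<^sup>2) - (\<zeta> + 1 / \<zeta>) / 2 * u (x\<^sup>2)) / ((\<zeta> - 1 / \<zeta>) / 2))"
proof -
  have u: "u (w\<^sup>2) = (s + 1 / s) / 2" if w: "w - 1 \<noteq> 0" "s = (w + 1) / (w - 1)" "s \<noteq> 0" for w s
  proof -
    have w1: "w + 1 \<noteq> 0" using w by auto
    have "(s + 1 / s) / 2 = ((w + 1) * (w + 1) + (w - 1) * (w - 1)) / (2 * ((w + 1) * (w - 1)))"
      unfolding w(2) using w(1) w1 two by (simp add: divide_simps)
    also have "\<dots> = (2 * (w\<^sup>2 + 1)) / (2 * (w\<^sup>2 - 1))"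
      by (simp add: power2_eq_square algebra_simps)
    also have "\<dots> = u (w\<^sup>2)" unfolding u_def using two by (rule mult_divide_mult_cancel_left)
    finally show ?thesis ..
  qed
  have bilinear: "(A * C + B * D) / 2 - (A + B) / 2 * ((C + D) / 2) = (A - B) / 2 * ((C - D) / 2)"
    for A B C D :: 'a
  proof -
    \<comment> \<open>Writing \<open>h\<close> for one half gives a polynomial identity, once
      \<open>2 h = 1\<close> is used to raise the first term to degree two in
      \<open>h\<close>.\<close>
    define h where "h = 1 / (2::'a)"
    have div: "t / 2 = t * h" for t by (simp add: h_def)
    have "2 * h = 1" using two by (simp add: h_def)
    then have E: "(A * C + B * D) * h = (A * C + B * D) * (2 * h) * h" by simp
    show ?thesis unfolding div by (subst E) (simp add: algebra_simps)
  qed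
  have z1: "\<zeta> * z \<noteq> 0" using \<zeta> x by simp
  have "u (y\<^sup>2) - (\<zeta> + 1 / \<zeta>) / 2 * u (x\<^sup>2) = (\<zeta> - 1 / \<zeta>) / 2 * ((z - 1 / z) / 2)"
    using bilinear[of \<zeta> z "1 / \<zeta>" "1 / z"] unfolding u[OF x] u[OF y z1] by simp
  moreover have "(\<zeta> - 1 / \<zeta>) / 2 \<noteq> 0"
    using \<zeta> two by (simp add: divide_simps power2_eq_square)
  ultimately have "(u (y\<^sup>2) - (\<zeta> + 1 / \<zeta>) / 2 * u (x\<^sup>2)) / ((\<zeta> - 1 / \<zeta>) / 2) = (z - 1 / z) / 2"
    by (metis nonzero_mult_div_cancel_left)
  moreover have "(x\<^sup>2 - 1) / 2 * ((z - 1 / z) / 2) = x"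
  proof -
    have x1: "x + 1 \<noteq> 0" using x by auto
    have "z - 1 / z = ((x + 1) * (x + 1) - (x - 1) * (x - 1)) / ((x + 1) * (x - 1))"
      unfolding x(2) using x(1) x1 by (simp add: divide_simps)
    also have "\<dots> = (2 * 2 * x) / (x\<^sup>2 - 1)"
      by (simp add: power2_eq_square algebra_simps)
    finally have "z - 1 / z = 2 * 2 * x / (x\<^sup>2 - 1)" .
    moreover have "x\<^sup>2 - 1 \<noteq> 0"
    proof -
      have "x\<^sup>2 - 1 = (x + 1) * (x - 1)" by (simp add: power2_eq_square algebra_simps)
      then show ?thesis using x1 x by simp
    qed
    \<comment> \<open>Applied with \<open>D = x^2 - 1\<close> and \<open>k = 2\<close>.\<close>
    moreover have "D / k * ((k * k * x / D) / k) = x" if "D \<noteq> 0" "k \<noteq> 0" for D k :: 'a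
      using that by simp
    ultimately show ?thesis using two by metis
  qed
  ultimately show ?thesis by metis
qed

lemma dihedral_rf_not_martingale:
  assumes r: "r \<ge> 2" and a: "a \<noteq> 0"
  defines "f \<equiv> dihedral_rf r a"
  shows "\<not> is_martingale (haar_prob (img f) (img_topology f)) (fixed_point_process f)"
proof -
  interpret nonconstant_rf f
    by standard (use r rf_degree_dihedral_rf[OF a, of r] in \<open>simp add: f_def\<close>)
  let ?q = "[:-1, 1:] ^ r :: complex poly"
  define S where "S = (\<lambda>z. ac.ev (half_poly r) z / ac.ev ?q z)"
  \<comment> \<open>A square root of \<open>a\<close>, so that \<open>c * S z\<close> is a square
    root of \<open>F z\<close>.\<close>
  define c where "c = ac_const (csqrt a)"
  have c0: "c \<noteq> 0" using a by (simp add: c_def)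
  have c2: "c\<^sup>2 = ac_const a" by (simp add: c_def flip: ac.hom_power)
  have two: "(2 :: complex poly fract alg_closure) \<noteq> 0"
  proof -
    have "ac_const (of_nat 2) = (2 :: complex poly fract alg_closure)"
      unfolding ac.hom_of_nat by simp
    then show ?thesis by (metis ac.hom_eq_0_iff of_nat_numeral zero_neq_numeral)
  qed
  have F_eq: "F z = c\<^sup>2 * (S z)\<^sup>2" for z
    unfolding ac.rf_eval_conv_ev S_def f_def rf_num_dihedral_rf[OF a] rf_den_dihedral_rf[OF a] c2
    by (simp add: power_divide mult.commute[of 2 r] power_mult)
  have S_sqrt: "S (x\<^sup>2) = (z ^ r + inverse (z ^ r)) / 2"
    if "x + 1 \<noteq> 0" "x - 1 \<noteq> 0" "z = (x + 1) / (x - 1)" for x z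
    using eval_dihedral_sqrt[OF two that(1,2), of r] that(3)
    by (simp add: S_def half_poly_def ac.ev_sum ac.hom_of_nat algebra_simps)
  obtain \<zeta> :: complex where \<zeta>: "\<zeta> ^ r = -1" "\<zeta> \<noteq> 0" "\<zeta>\<^sup>2 \<noteq> 1" using root_of_minus_one[OF r] .
  define Z where "Z = ac_const \<zeta>"
  have Z: "Z ^ r = -1" "Z \<noteq> 0" "Z\<^sup>2 \<noteq> 1"
  proof -
    show "Z ^ r = -1" using \<zeta>(1) by (simp add: Z_def flip: ac.hom_power)
    show "Z \<noteq> 0" using \<zeta>(2) by (simp add: Z_def)
    have "ac_const (\<zeta>\<^sup>2 - 1) \<noteq> 0" using \<zeta>(3) unfolding ac.hom_eq_0_iff by simp
    moreover have "ac_const (\<zeta>\<^sup>2 - 1) = Z\<^sup>2 - 1"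
      using ac.hom_add[of "\<zeta>\<^sup>2" "-1"] ac.hom_minus[of 1] by (simp add: Z_def)
    ultimately show "Z\<^sup>2 \<noteq> 1" by simp
  qed
  have sqrt_in: "x \<in> K 1" if v: "x\<^sup>2 \<in> L 1" for x
  proof -
    have nr: "x\<^sup>2 \<notin> range ac_const" by (rule level_transcendental[OF v])
    have x: "x \<notin> range ac_const"
    proof
      assume "x \<in> range ac_const"
      then obtain b where "x = ac_const b" by blast
      then have "x\<^sup>2 = ac_const (b\<^sup>2)" by simp
      then show False using nr by blast
    qed
    have x1: "x + 1 \<noteq> 0" "x - 1 \<noteq> 0"
    proof -
      show "x + 1 \<noteq> 0" using x ac.hom_minus[of 1] by (metis ac.hom_1 eq_neg_iff_add_eq_0 rangeI)
      show "x - 1 \<noteq> 0" using x by (metis ac.hom_1 eq_iff_diff_eq_0 rangeI)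
    qed
    define z where "z = (x + 1) / (x - 1)"
    have z0: "z \<noteq> 0" using x1 by (simp add: z_def)
    \<comment> \<open>Otherwise \<open>z\<close>, and with it \<open>x\<close>, would be a
      constant.\<close>
    have zZ: "Z * z - 1 \<noteq> 0"
    proof
      assume "Z * z - 1 = 0"
      then have z: "z = ac_const (1 / \<zeta>)" using Z(2) by (simp add: Z_def field_simps)
      have "x * (z - 1) = z + 1" using x1(2) unfolding z_def by (simp add: field_simps)
      moreover have "z - 1 \<noteq> 0"
        using two x1 by (simp add: z_def field_simps)
      ultimately have "x = (z + 1) / (z - 1)" by (simp add: field_simps)
      also have "\<dots> = ac_const ((1 / \<zeta> + 1) / (1 / \<zeta> + (- 1)))"
        unfolding z ac.hom_divide ac.hom_add ac.hom_minus ac.hom_1 by simp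
      finally show False using x by blast
    qed
    \<comment> \<open>The Moebius map from \<open>x\<close> to \<open>z\<close> is its own inverse;
      \<open>y\<close> is the point that it sends to \<open>Z * z\<close>.\<close>
    define y where "y = (Z * z + 1) / (Z * z - 1)"
    have y: "y - 1 \<noteq> 0" "Z * z = (y + 1) / (y - 1)"
    proof -
      have ym: "y - 1 = 2 / (Z * z - 1)" and yp: "y + 1 = 2 * (Z * z) / (Z * z - 1)"
        using zZ by (simp_all add: y_def field_simps)
      show "y - 1 \<noteq> 0" using ym two zZ by simp
      show "Z * z = (y + 1) / (y - 1)" unfolding ym yp using two zZ by simp
    qed
    have yp: "y + 1 \<noteq> 0" using y z0 Z(2) by auto
    \<comment> \<open>Replacing \<open>z\<close> by \<open>Z * z\<close> changes the sign of
      \<open>z^r\<close>, which squaring in \<open>F\<close> hides. So \<open>y^2\<close> is a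
      second vertex of level 1.\<close>
    have "S (y\<^sup>2) = - S (x\<^sup>2)"
      unfolding S_sqrt[OF x1 z_def] S_sqrt[OF yp y] by (simp add: power_mult_distrib Z(1) minus_divide_left)
    then have "F (y\<^sup>2) = F (x\<^sup>2)" by (simp add: F_eq)
    then have "y\<^sup>2 \<in> L 1" using v level_Suc_iff[of _ 0] by simp
    then have "y\<^sup>2 \<in> K 1" "x\<^sup>2 \<in> K 1" using v splitting_field_level by blast+
    moreover have "Z \<in> K 1" "1 \<in> K 1" "2 \<in> K 1"
      using splitting_field_const splitting_field_base[of 1] splitting_field_base[of 2] by (simp_all add: Z_def)
    ultimately show "x \<in> K 1"
      by (subst sqrt_from_two_roots[OF two x1(2) z_def z0 y Z(2,3)])
        (intro splitting_field_mult splitting_field_divide splitting_field_diff splitting_field_add)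
  qed
  have S_in: "S w \<in> K 1" if w: "w \<in> L 2" for w
  proof -
    obtain x where x: "x\<^sup>2 = F w" using nth_root_exists[of 2 "F w"] by auto
    have "x\<^sup>2 \<in> L 1" using w level_Suc_iff[of w 1] x by (simp add: numeral_2_eq_2)
    then have xK: "x \<in> K 1" by (rule sqrt_in)
    have "x\<^sup>2 = (c * S w)\<^sup>2" using x F_eq by (simp add: power_mult_distrib)
    then have "x = c * S w \<or> x = - (c * S w)" by (simp add: power2_eq_iff)
    then have "S w = x / c \<or> S w = - x / c" using c0 by auto
    moreover have cK: "c \<in> K 1" unfolding c_def by (rule splitting_field_const)
    ultimately show ?thesis
      using splitting_field_divide[OF xK cK] splitting_field_divide[OF splitting_field_minus[OF xK] cK] by auto
  qed
  have "card (L 1) < card (S ` L 2)"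
  proof (rule ccontr)
    let ?\<phi> = "\<lambda>y. c\<^sup>2 * y\<^sup>2"
    assume "\<not> card (L 1) < card (S ` L 2)"
    moreover have fin: "finite (S ` L 2)" using finite_level by simp
    have L2: "w \<in> L 2 \<longleftrightarrow> ?\<phi> (S w) \<in> L 1" for w
      using level_Suc_iff[of w 1] by (simp add: F_eq numeral_2_eq_2)
    have img: "?\<phi> ` S ` L 2 = L 1"
    proof (intro equalityI subsetI)
      fix v assume "v \<in> L 1"
      then obtain w where "w \<in> L 2" "F w = v" using level_surj[of v 1] by (metis Suc_1)
      then show "v \<in> ?\<phi> ` S ` L 2" using F_eq by blast
    qed (use L2 in blast)
    ultimately have "card (?\<phi> ` S ` L 2) = card (S ` L 2)"
      using card_image_le[OF fin, of ?\<phi>] by simp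
    then have inj: "inj_on ?\<phi> (S ` L 2)" by (rule eq_card_imp_inj_on[OF fin])
    obtain v where v: "v \<in> L 1" using level_surj[of _ 0] level_0 by (metis One_nat_def insertI1)
    then obtain y where y: "y \<in> S ` L 2" "v = ?\<phi> y" using img by blast
    have ny: "- y \<notin> range ac_const"
    proof
      assume "- y \<in> range ac_const"
      then obtain b where "- y = ac_const b" by blast
      then have "y = ac_const (- b)" by (metis ac.hom_minus minus_minus)
      then have "v = ac_const (a * (- b)\<^sup>2)" using y(2) c2 by simp
      then show False using level_transcendental[OF v] by blast
    qed
    \<comment> \<open>Nonconstant values are attained by \<open>S\<close>, so \<open>- y\<close> is
      also a value, and \<open>F w = v\<close> puts \<open>w\<close> on level 2.\<close>
    obtain w where "ac.ev (half_poly r) w / ac.ev ?q w = - y"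
    proof (rule ac.fibre_nonempty[OF _ ny coprime_half_poly])
      show "\<exists>x. poly p x = 0" if "0 < Polynomial.degree p" for p :: "complex poly fract alg_closure poly"
        using alg_closed_imp_poly_has_root[OF that] by blast
      show "0 < Polynomial.degree (half_poly r) \<or> 0 < Polynomial.degree ?q"
        using r by (simp add: degree_half_poly)
    qed
    then have "S w = - y" by (simp add: S_def)
    then have my: "- y \<in> S ` L 2" using L2[of w] y v by (metis imageI power2_minus)
    have "- y = y" by (rule inj_onD[OF inj _ my y(1)]) simp
    \<comment> \<open>Then \<open>v\<close> would be 0, contradicting that vertices are not
      constants.\<close>
    then have "2 * y = 0" by (metis mult_2 add.left_inverse)
    then have "v = ac_const 0" using two y(2) by simp
    then show False using level_transcendental[OF v] by blast
  qed
  then show ?thesis using not_martingale[of "half_poly r" ?q] S_in unfolding S_def by blast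
qed

theorem theorem1p3:
  fixes m :: nat
  assumes "even m" and "m \<ge> 4"
  shows "infinite {f :: complex poly fract. rf_degree f = m \<and>
    \<not> is_martingale (haar_prob (img f) (img_topology f)) (fixed_point_process f)}"
proof -
  obtain r where m: "m = 2 * r" using assms(1) by blast
  \<comment> \<open>The scalars \<open>a = 1, 2, 3, ...\<close> are nonzero and are read off from
    the leading coefficients of the numerators in lowest terms.\<close>
  have "inj (\<lambda>n. dihedral_rf r (of_nat (Suc n)))"
  proof (rule injI)
    fix k n assume "dihedral_rf r (of_nat (Suc k)) = dihedral_rf r (of_nat (Suc n))"
    then have "rf_num (dihedral_rf r (of_nat (Suc k))) = rf_num (dihedral_rf r (of_nat (Suc n)))"
      by simp
    then have "Polynomial.smult (of_nat (Suc k)) ((half_poly r)\<^sup>2) = Polynomial.smult (of_nat (Suc n)) ((half_poly r)\<^sup>2)"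
      by (simp add: rf_num_dihedral_rf del: of_nat_Suc)
    then have "Polynomial.lead_coeff ((half_poly r)\<^sup>2) * of_nat (Suc k) = Polynomial.lead_coeff ((half_poly r)\<^sup>2) * of_nat (Suc n)"
      by (metis lead_coeff_smult mult.commute)
    then show "k = n" by (simp del: of_nat_Suc)
  qed
  then have "infinite (range (\<lambda>n. dihedral_rf r (of_nat (Suc n))))"
    by (rule range_inj_infinite)
  moreover have "range (\<lambda>n. dihedral_rf r (of_nat (Suc n))) \<subseteq> {f. rf_degree f = m \<and>
    \<not> is_martingale (haar_prob (img f) (img_topology f)) (fixed_point_process f)}"
    using assms(2) rf_degree_dihedral_rf dihedral_rf_not_martingale[of r] m by (auto simp del: of_nat_Suc)
  ultimately show ?thesis using infinite_super by blast
qed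

end
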